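(* $T_\varphi=\Gamma_\lambda$ as schemes (i.e. as closed subschemes of $T$).
   Context: Let $K$ be an algebraically closed field of characteristic zero, $d\ge 1$ an integer, $V=K[x,y]_1$ the space of linear forms in $x,y$, and $\lambda=(1^{e_1}2^{e_2}\cdots d^{e_d})$ a partition of $d$, where $e_r\ge 0$ is the number of parts equal to $r$ (so $\sum_{r=1}^d r e_r=d$). A closed point $(b_0:\cdots:b_k)$ of $\mathbb{P}(\mathrm{Sym}^kV)\cong\mathbb{P}^k_K$ is identified with the binary form $\sum_{j=0}^k b_jx^{k-j}y^j$ up to scalars in $K^*$. Put $Y_\lambda=\prod_{r=1}^d\mathbb{P}(\mathrm{Sym}^{e_r}V)$ and $T=\mathbb{P}(\mathrm{Sym}^dV)\times Y_\lambda$. Let $f_\lambda:Y_\lambda\to\mathbb{P}(\mathrm{Sym}^dV)$ be the morphism $(G_1,\dots,G_d)\mapsto\prod_{r=1}^dG_r^r$, and let $X_\lambda=\mathrm{im}(f_\lambda)$, an integral closed subscheme of $\mathbb{P}(\mathrm{Sym}^dV)$. Let $\Gamma_\lambda\subseteq T$ be the graph of $f_\lambda$, i.e. $\Gamma_\lambda=X_\lambda\times_{X_\lambda}Y_\lambda$ viewed as a closed subscheme of $T$ isomorphic to $Y_\lambda$; its closed points are the $(F,G_1,\dots,G_d)$ with $F=\prod_{r=1}^dG_r^r$. Let $e_0=d$ and $\Lambda=\{0,\dots,e_0\}\times\{0,\dots,e_1\}\times\cdots\times\{0,\dots,e_d\}$. For $\underline\alpha=(\alpha_0,\dots,\alpha_d)\in\Lambda$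 let $U_{\underline\alpha}=U_{\alpha_0}\times\cdots\times U_{\alpha_d}\subseteq T$, where $U_{\alpha_r}$ is the $\alpha_r$-th standard affine chart (the $\alpha_r$-th homogeneous coordinate is nonzero and normalized to $1$) of $\mathbb{P}(\mathrm{Sym}^{e_r}V)$, for $r=0,\dots,d$. The $U_{\underline\alpha}$ form an affine open cover of $T$. Let $z_j$ ($0\le j\le d$, $j\ne\alpha_0$) be the affine coordinates on $U_{\alpha_0}\subset\mathbb{P}(\mathrm{Sym}^dV)$, put $z_{\alpha_0}=1$, and let $w_{r,t}$ ($1\le r\le d$, $0\le t\le e_r$, $t\neq\alpha_r$) be the affine coordinates on $U_{\alpha_r}\subset\mathbb{P}(\mathrm{Sym}^{e_r}V)$; thus $\mathcal{O}(U_{\underline\alpha})$ is the polynomial ring over $K$ in all these coordinates. Let $\Theta_0,\dots,\Theta_d$ be the polynomials in indeterminates $W_{r,t}$ ($1\le r\le d$, $0\le t\le e_r$) defined by the identity $$\prod_{r=1}^d\Big(\sum_{t=0}^{e_r}W_{r,t}x^{e_r-t}y^t\Big)^r=\sum_{j=0}^d\Theta_j\,x^{d-j}y^j .$$ Let $\theta_{j}=\theta_{j,\underline\alpha}\in\mathcal{O}(U_{\underline\alpha})$ be obtained from $\Theta_j$ by substituting $W_{r,\alpha_r}\mapsto 1$ and $W_{r,t}\mapsto w_{r,t}$ for $t\ne\alpha_r$. Define the $2\times(d+1)$ matrix over $\mathcal{O}(U_{\underline\alpha})$ $$(\varphi_{\underline\alpha})=\begin{pmatrix}\theta_{0}&\cdots&\theta_{\alpha_0-1}&\theta_{\alpha_0}&\theta_{\alpha_0+1}&\cdots&\theta_{d}\\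 z_{0}&\cdots&z_{\alpha_0-1}&1&z_{\alpha_0+1}&\cdots&z_{d}\end{pmatrix}.$$ $T_\varphi$ denotes the closed subscheme of $T$ such that, for every $\underline\alpha\in\Lambda$, the ideal of $T_\varphi\cap U_{\underline\alpha}$ in $\mathcal{O}(U_{\underline\alpha})$ is generated by the $2\times2$-minors of $(\varphi_{\underline\alpha})$ (these local ideals, the zeroth Fitting ideals of the cokernels of the $\varphi_{\underline\alpha}$, agree on overlaps). *)

theory Defs
  imports
    "HOL-Algebra.RingHom"
    "HOL-Library.Poly_Mapping"
    "HOL-Library.Product_Lexorder"
    "HOL-Computational_Algebra.Computational_Algebra"
begin

section \<open>Polynomial rings, fractions and subrings\<close>

text \<open>
  The indeterminate \<open>(r, t)\<close> stands for the \<open>t\<close>-th coordinate of the \<open>r\<close>-th factor of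
  \<open>T = P(Sym^d V) \<times> P(Sym^(e 1) V) \<times> \<dots> \<times> P(Sym^(e d) V)\<close>: thus \<open>(0, j)\<close> is \<open>Z_j\<close> (or \<open>z_j\<close>), and for
  \<open>r \<ge> 1\<close> the pair \<open>(r, t)\<close> is \<open>W_{r,t}\<close> (or \<open>w_{r,t}\<close>).  The partition is given by its multiplicities
  \<open>e r\<close>, and \<open>e 0 = d\<close> throughout.
\<close>

type_synonym 'k mpoly = "((nat \<times> nat) \<Rightarrow>\<^sub>0 nat) \<Rightarrow>\<^sub>0 'k"

definition const :: "'k \<Rightarrow> 'k::field mpoly" where
  "const c = Poly_Mapping.single 0 c"

definition var :: "nat \<times> nat \<Rightarrow> 'k::field mpoly" where
  "var v = Poly_Mapping.single (Poly_Mapping.single v 1) 1"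

definition polys_in :: "(nat \<times> nat) set \<Rightarrow> 'k::field mpoly set" where
  "polys_in A = {p. \<forall>m \<in> Poly_Mapping.keys p. Poly_Mapping.keys m \<subseteq> A}"

text \<open>The substitution \<open>(r, t) \<mapsto> \<rho> (r, t)\<close>, with \<open>h\<close> the map on coefficients.\<close>

definition subst :: "('k \<Rightarrow> 'a) \<Rightarrow> (nat \<times> nat \<Rightarrow> 'a) \<Rightarrow> 'k::field mpoly \<Rightarrow> 'a::comm_ring_1" where
  "subst h \<rho> p =
     (\<Sum>m \<in> Poly_Mapping.keys p. h (Poly_Mapping.lookup p m) *
        (\<Prod>v \<in> Poly_Mapping.keys m. \<rho> v ^ Poly_Mapping.lookup m v))"

abbreviation frac :: "'a::idom \<Rightarrow> 'a fract" where
  "frac a \<equiv> Fraction_Field.Fract a 1"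

definition ring_on :: "'a::comm_ring_1 set \<Rightarrow> 'a ring" where
  "ring_on A = \<lparr>carrier = A, monoid.mult = (*), one = 1, zero = 0, add = (+)\<rparr>"


section \<open>The affine cover of \<open>T\<close> and closed subschemes of \<open>T\<close>\<close>

definition Lambda :: "nat \<Rightarrow> (nat \<Rightarrow> nat) \<Rightarrow> (nat \<Rightarrow> nat) set" where
  "Lambda d e = (\<Pi>\<^sub>E r\<in>{0..d}. {0..e r})"

definition chart_ring :: "nat \<Rightarrow> (nat \<Rightarrow> nat) \<Rightarrow> (nat \<Rightarrow> nat) \<Rightarrow> 'k::field mpoly ring" where
  "chart_ring d e \<alpha> = ring_on (polys_in {(r, t). r \<le> d \<and> t \<le> e r \<and> t \<noteq> \<alpha> r})"

definition coord :: "(nat \<Rightarrow> nat) \<Rightarrow> nat \<times> nat \<Rightarrow> 'k::field mpoly" where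
  "coord \<alpha> = (\<lambda>(r, t). if t = \<alpha> r then 1 else var (r, t))"

text \<open>
  The embedding of \<open>O(U_\<alpha>)\<close> into the field of fractions of the multihomogeneous coordinate ring of
  \<open>T\<close>, sending the affine coordinate \<open>(r, t)\<close> to the ratio of the homogeneous coordinates \<open>(r, t)\<close> and
  \<open>(r, \<alpha> r)\<close>.  Its image lies in the function field of \<open>T\<close>, where all charts can be compared.
\<close>

definition chart_emb :: "(nat \<Rightarrow> nat) \<Rightarrow> 'k::field mpoly \<Rightarrow> 'k mpoly fract" where
  "chart_emb \<alpha> = subst (\<lambda>c. frac (const c)) (\<lambda>(r, t). frac (var (r, t)) / frac (var (r, \<alpha> r)))"

text \<open>
  \<open>O(U_\<alpha> \<inter> U_\<beta>)\<close>, inside the function field of \<open>T\<close>: the localization of \<open>O(U_\<alpha>)\<close> at the affine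
  coordinates \<open>(r, \<beta> r)\<close>.
\<close>

definition overlap_ring ::
  "nat \<Rightarrow> (nat \<Rightarrow> nat) \<Rightarrow> (nat \<Rightarrow> nat) \<Rightarrow> (nat \<Rightarrow> nat) \<Rightarrow> 'k::field mpoly fract ring" where
  "overlap_ring d e \<alpha> \<beta> =
     ring_on {chart_emb \<alpha> p / chart_emb \<alpha> (\<Prod>r\<le>d. coord \<alpha> (r, \<beta> r)) ^ n | p n.
       p \<in> carrier (chart_ring d e \<alpha>)}"

text \<open>
  A closed subscheme of \<open>T\<close>, i.e. a quasi-coherent sheaf of ideals on \<open>T\<close>, is represented by its
  ideals in the coordinate rings \<open>O(U_\<alpha>)\<close> of the affine cover, which have to extend to the same
  ideal of \<open>O(U_\<alpha> \<inter> U_\<beta>)\<close> on every overlap.  Being extensional outside \<open>Lambda d e\<close>, two such families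
  are equal iff the closed subschemes are.
\<close>

type_synonym 'k ideal_family = "(nat \<Rightarrow> nat) \<Rightarrow> 'k mpoly set"

definition closed_subscheme :: "nat \<Rightarrow> (nat \<Rightarrow> nat) \<Rightarrow> 'k::field ideal_family \<Rightarrow> bool" where
  "closed_subscheme d e I \<longleftrightarrow>
     I \<in> extensional (Lambda d e) \<and>
     (\<forall>\<alpha> \<in> Lambda d e. ideal (I \<alpha>) (chart_ring d e \<alpha>)) \<and>
     (\<forall>\<alpha> \<in> Lambda d e. \<forall>\<beta> \<in> Lambda d e.
        Idl\<^bsub>overlap_ring d e \<alpha> \<beta>\<^esub> (chart_emb \<alpha> ` I \<alpha>) =
        Idl\<^bsub>overlap_ring d e \<alpha> \<beta>\<^esub> (chart_emb \<beta> ` I \<beta>))"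


section \<open>The closed subscheme \<open>T_\<phi>\<close>\<close>

text \<open>
  Binary forms over a ring \<open>R\<close> are elements of \<open>R[y][x]\<close>, so \<open>c x^i y^j\<close> is \<open>monom (monom c j) i\<close>.
\<close>

definition generic_product :: "nat \<Rightarrow> (nat \<Rightarrow> nat) \<Rightarrow> 'k::field mpoly poly poly" where
  "generic_product d e = (\<Prod>r=1..d. (\<Sum>t=0..e r. monom (monom (var (r, t)) t) (e r - t)) ^ r)"

definition Theta :: "nat \<Rightarrow> (nat \<Rightarrow> nat) \<Rightarrow> nat \<Rightarrow> 'k::field mpoly" where
  "Theta d e j = coeff (coeff (generic_product d e) (d - j)) j"

definition theta :: "nat \<Rightarrow> (nat \<Rightarrow> nat) \<Rightarrow> (nat \<Rightarrow> nat) \<Rightarrow> nat \<Rightarrow> 'k::field mpoly" where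
  "theta d e \<alpha> j = subst const (coord \<alpha>) (Theta d e j)"

definition phi :: "nat \<Rightarrow> (nat \<Rightarrow> nat) \<Rightarrow> (nat \<Rightarrow> nat) \<Rightarrow> nat \<Rightarrow> nat \<Rightarrow> 'k::field mpoly" where
  "phi d e \<alpha> i j = (if i = 0 then theta d e \<alpha> j else coord \<alpha> (0, j))"

definition minors2 :: "nat \<Rightarrow> (nat \<Rightarrow> nat \<Rightarrow> 'a::comm_ring_1) \<Rightarrow> 'a set" where
  "minors2 d M = {M 0 i * M 1 j - M 0 j * M 1 i | i j. i < j \<and> j \<le> d}"

definition T_phi :: "nat \<Rightarrow> (nat \<Rightarrow> nat) \<Rightarrow> 'k::field ideal_family" where
  "T_phi d e = (\<lambda>\<alpha>\<in>Lambda d e. Idl\<^bsub>chart_ring d e \<alpha>\<^esub> (minors2 d (phi d e \<alpha>)))"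


section \<open>The graph of \<open>f_\<lambda>\<close>\<close>

text \<open>
  \<open>\<Gamma>_\<lambda>\<close> is the image of the closed immersion \<open>\<gamma> = (f_\<lambda>, id) : Y_\<lambda> \<rightarrow> T\<close>, hence its ideal on \<open>U_\<alpha>\<close> is the
  kernel of \<open>\<gamma>^# : O(U_\<alpha>) \<rightarrow> O_Y(\<gamma>^{-1}(U_\<alpha>))\<close>.  The open set \<open>\<gamma>^{-1}(U_\<alpha>)\<close> is the locus in the chart
  \<open>U_{\<alpha> 1} \<times> \<dots> \<times> U_{\<alpha> d}\<close> of \<open>Y_\<lambda>\<close> where the coefficient \<open>\<theta>_{\<alpha> 0}\<close> of \<open>\<Prod>r. G_r^r\<close> is invertible, so its
  ring of functions is the localization of \<open>K[w]\<close> at \<open>\<theta>_{\<alpha> 0}\<close>.  In characteristic zero \<open>\<theta>_{\<alpha> 0}\<close> is a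
  nonzero polynomial in the \<open>w_{r,t}\<close>, so that this localization can be taken inside the field of
  fractions.  There \<open>\<gamma>^#\<close> sends \<open>z_j\<close> to \<open>\<theta>_j / \<theta>_{\<alpha> 0}\<close> and \<open>w_{r,t}\<close> to itself.
\<close>

definition graph_preimage_ring ::
  "nat \<Rightarrow> (nat \<Rightarrow> nat) \<Rightarrow> (nat \<Rightarrow> nat) \<Rightarrow> 'k::field mpoly fract ring" where
  "graph_preimage_ring d e \<alpha> =
     ring_on {frac a / frac (theta d e \<alpha> (\<alpha> 0)) ^ n | a n.
       a \<in> polys_in {(r, t). 1 \<le> r \<and> r \<le> d \<and> t \<le> e r \<and> t \<noteq> \<alpha> r}}"

definition graph_comorphism ::
  "nat \<Rightarrow> (nat \<Rightarrow> nat) \<Rightarrow> (nat \<Rightarrow> nat) \<Rightarrow> 'k::field mpoly \<Rightarrow> 'k mpoly fract" where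
  "graph_comorphism d e \<alpha> =
     subst (\<lambda>c. frac (const c))
       (\<lambda>(r, t). if r = 0 then frac (theta d e \<alpha> t) / frac (theta d e \<alpha> (\<alpha> 0))
                 else frac (coord \<alpha> (r, t)))"

definition Gamma :: "nat \<Rightarrow> (nat \<Rightarrow> nat) \<Rightarrow> 'k::field ideal_family" where
  "Gamma d e =
     (\<lambda>\<alpha>\<in>Lambda d e.
        a_kernel (chart_ring d e \<alpha>) (graph_preimage_ring d e \<alpha>) (graph_comorphism d e \<alpha>))"


section \<open>Consistency of the definition of \<open>\<Theta>_j\<close>\<close>

definition homog :: "nat \<Rightarrow> 'a::comm_ring_1 poly poly \<Rightarrow> bool" where
  "homog n P \<longleftrightarrow> (\<forall>i j. coeff (coeff P i) j \<noteq> 0 \<longrightarrow> i + j = n)"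

lemma homog_mult:
  assumes "homog m P" "homog n Q"
  shows "homog (m + n) (P * Q)"
  unfolding homog_def
proof (intro allI impI)
  fix i j assume "coeff (coeff (P * Q) i) j \<noteq> 0"
  then have "(\<Sum>a\<le>i. \<Sum>b\<le>j. coeff (coeff P a) b * coeff (coeff Q (i - a)) (j - b)) \<noteq> 0"
    by (simp add: coeff_mult coeff_sum)
  then obtain a b where "a \<le> i" "b \<le> j" "coeff (coeff P a) b * coeff (coeff Q (i - a)) (j - b) \<noteq> 0"
    by (meson atMost_iff sum.not_neutral_contains_not_neutral)
  moreover from this have "a + b = m" "(i - a) + (j - b) = n"
    using assms unfolding homog_def by (metis mult_zero_left, metis mult_zero_right)
  ultimately show "i + j = m + n" by linarith
qed

lemma homog_1: "homog 0 1"
  unfolding homog_def by (auto simp: coeff_1 split: if_splits)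

lemma homog_power: "homog n P \<Longrightarrow> homog (r * n) (P ^ r)"
  by (induction r) (simp_all add: homog_1 homog_mult)

lemma homog_prod:
  assumes "finite A" "\<And>r. r \<in> A \<Longrightarrow> homog (n r) (P r)"
  shows "homog (\<Sum>r\<in>A. n r) (\<Prod>r\<in>A. P r)"
  using assms by (induction A rule: finite_induct) (simp_all add: homog_1 homog_mult)

lemma homog_form: "homog n (\<Sum>t=0..n. monom (monom (c t) t) (n - t))"
  unfolding homog_def
proof (intro allI impI)
  fix i j assume "coeff (coeff (\<Sum>t=0..n. monom (monom (c t) t) (n - t)) i) j \<noteq> 0"
  then have "(\<Sum>t=0..n. coeff (coeff (monom (monom (c t) t) (n - t)) i) j) \<noteq> 0"
    by (simp add: coeff_sum)
  then obtain t where "t \<in> {0..n}" "coeff (coeff (monom (monom (c t) t) (n - t)) i) j \<noteq> 0"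
    by (meson sum.not_neutral_contains_not_neutral)
  then show "i + j = n" by (auto split: if_splits)
qed

lemma homog_expand:
  assumes "homog d P"
  shows "P = (\<Sum>j=0..d. monom (monom (coeff (coeff P (d - j)) j) j) (d - j))"
proof (intro poly_eqI)
  fix i j
  have "coeff (coeff (\<Sum>k=0..d. monom (monom (coeff (coeff P (d - k)) k) k) (d - k)) i) j =
      (\<Sum>k=0..d. if k = j then (if d - j = i then coeff (coeff P (d - j)) j else 0) else 0)"
    unfolding coeff_sum by (intro sum.cong) auto
  also have "\<dots> = coeff (coeff P i) j"
  proof (cases "coeff (coeff P i) j = 0")
    case True
    then show ?thesis by (auto simp: sum.delta)
  next
    case False
    then have "i + j = d" using assms unfolding homog_def by blast
    then show ?thesis by (auto simp: sum.delta)
  qed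
  finally show "coeff (coeff P i) j =
      coeff (coeff (\<Sum>k=0..d. monom (monom (coeff (coeff P (d - k)) k) k) (d - k)) i) j" by simp
qed

lemma generic_product_eq:
  assumes "(\<Sum>r=1..d. r * e r) = d"
  shows "generic_product d e = (\<Sum>j=0..d. monom (monom (Theta d e j) j) (d - j))"
  unfolding Theta_def
proof (rule homog_expand)
  have "homog (\<Sum>r=1..d. r * e r) (generic_product d e)"
    unfolding generic_product_def by (intro homog_prod homog_power homog_form finite_atLeastAtMost)
  then show "homog d (generic_product d e)" by (simp only: assms)
qed

end

theory Submission
  imports Defs
begin

text \<open>
  Fix a chart and write \<open>\<theta>\<^sub>j\<close> for the coefficients of \<open>\<Prod>r. G\<^sub>r ^ r\<close>, polynomials in the parameters \<open>w\<close>, and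
  \<open>a = \<alpha> 0\<close> for the index with \<open>z\<^sub>a = 1\<close>.  Modulo the ideal \<open>I\<close> of the \<open>2 \<times> 2\<close> minors, \<open>\<theta>\<^sub>j = z\<^sub>j \<theta>\<^sub>a\<close> for every
  \<open>j\<close>.  On the open set where \<open>\<theta>\<^sub>a\<close> is invertible these equations say \<open>z\<^sub>j = \<theta>\<^sub>j / \<theta>\<^sub>a\<close> and define the graph,
  so in general the ideal of the graph is the saturation of \<open>I\<close> by \<open>\<theta>\<^sub>a\<close>.  The equality therefore amounts
  to \<open>\<theta>\<^sub>a\<close> not being a zero divisor modulo \<open>I\<close>, and in fact it is a unit.

  The reason is that the \<open>\<theta>\<^sub>j\<close> generate the unit ideal: a product of nonzero forms is nonzero at every
  point.  This is proved without points, by McCoy's argument (\<open>mccoy_cancel\<close>): a polynomial with a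
  coefficient that is regular modulo \<open>J\<close> can be cancelled in any product whose coefficients all lie in
  \<open>J\<close>.  Each \<open>G\<^sub>r\<close> has the coefficient \<open>1\<close> at its normalized position, so if \<open>J\<close> contains all \<open>\<theta>\<^sub>j\<close>, then
  cancelling all factors leaves \<open>1 \<in> J\<close> (\<open>power_product_unit_content\<close>).  Applied to \<open>J = I + (\<theta>\<^sub>a)\<close>,
  which contains \<open>\<theta>\<^sub>j = (\<theta>\<^sub>j - z\<^sub>j \<theta>\<^sub>a) + z\<^sub>j \<theta>\<^sub>a\<close>, this yields the inverse of \<open>\<theta>\<^sub>a\<close> modulo \<open>I\<close>
  (\<open>theta_invertible_mod_minors\<close>).

  If \<open>p\<close> vanishes on the graph, then \<open>\<theta>\<^sub>a ^ n p\<close> is congruent modulo \<open>I\<close> to a polynomial in \<open>w\<close> alone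
  (\<open>chart_poly_reduces_to_param\<close>); that polynomial vanishes on the graph as well, hence is \<open>0\<close>, because
  the graph projects dominantly to the parameter space.  Thus \<open>\<theta>\<^sub>a ^ n p \<in> I\<close>, and inverting \<open>\<theta>\<^sub>a\<close> gives
  \<open>p \<in> I\<close>.

  The local ideals glue because in homogeneous coordinates the minors on \<open>U_\<alpha>\<close> are
  \<open>\<Theta>\<^sub>i Z\<^sub>j - \<Theta>\<^sub>j Z\<^sub>i\<close> divided by a monomial that depends on \<open>\<alpha>\<close> only (\<open>chart_emb_minor\<close>).
  Minors on two charts thus differ by a factor which is a unit on the overlap.  Having proved this for
  \<open>T_\<phi>\<close>, one has it for the graph too, by the equality.
\<close>

section \<open>Homomorphisms and substitution\<close>

text \<open>
  Semirings are allowed so that \<open>of_nat\<close> is covered: positivity of coefficients is checked over \<open>nat\<close>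
  and then transported to the field.
\<close>

definition semiring_hom :: "('a::comm_semiring_1 \<Rightarrow> 'b::comm_semiring_1) \<Rightarrow> bool" where
  "semiring_hom f \<longleftrightarrow> f 0 = 0 \<and> f 1 = 1 \<and>
     (\<forall>a b. f (a + b) = f a + f b) \<and> (\<forall>a b. f (a * b) = f a * f b)"

lemma semiring_hom_0: "semiring_hom f \<Longrightarrow> f 0 = 0"
  and semiring_hom_1: "semiring_hom f \<Longrightarrow> f 1 = 1"
  and semiring_hom_add: "semiring_hom f \<Longrightarrow> f (a + b) = f a + f b"
  and semiring_hom_mult: "semiring_hom f \<Longrightarrow> f (a * b) = f a * f b"
  by (simp_all add: semiring_hom_def)

lemmas semiring_hom_simps = semiring_hom_0 semiring_hom_1 semiring_hom_add semiring_hom_mult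

lemma semiring_hom_sum: "semiring_hom f \<Longrightarrow> f (sum g A) = (\<Sum>x\<in>A. f (g x))"
  by (induction A rule: infinite_finite_induct) (simp_all add: semiring_hom_simps)

lemma semiring_hom_prod: "semiring_hom f \<Longrightarrow> f (prod g A) = (\<Prod>x\<in>A. f (g x))"
  by (induction A rule: infinite_finite_induct) (simp_all add: semiring_hom_simps)

lemma semiring_hom_power: "semiring_hom f \<Longrightarrow> f (a ^ n) = f a ^ n"
  by (induction n) (simp_all add: semiring_hom_simps)

lemma semiring_hom_diff:
  fixes f :: "'a::comm_ring_1 \<Rightarrow> 'b::comm_ring_1"
  assumes "semiring_hom f"
  shows "f (a - b) = f a - f b"
  using semiring_hom_add[OF assms, of "a - b" b] by (simp add: algebra_simps)

lemma semiring_hom_comp: "semiring_hom f \<Longrightarrow> semiring_hom g \<Longrightarrow> semiring_hom (\<lambda>x. f (g x))"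
  by (simp add: semiring_hom_def)

lemma semiring_hom_id: "semiring_hom (\<lambda>x. x)"
  by (simp add: semiring_hom_def)

lemma semiring_hom_of_nat: "semiring_hom of_nat"
  by (simp add: semiring_hom_def)

lemma semiring_hom_frac: "semiring_hom (\<lambda>a. frac a)"
  by (simp add: semiring_hom_def Zero_fract_def One_fract_def)

lemma frac_eq_0_iff: "frac a = 0 \<longleftrightarrow> a = 0"
  by (simp add: Zero_fract_def eq_fract)

lemma semiring_hom_const: "semiring_hom const"
  by (simp add: semiring_hom_def const_def single_add mult_single)

lemma semiring_hom_frac_const: "semiring_hom (\<lambda>c. frac (const c))"
  by (rule semiring_hom_comp[OF semiring_hom_frac semiring_hom_const])

lemma subst_cover:
  assumes "h 0 = 0" "finite M" "Poly_Mapping.keys p \<subseteq> M"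
  shows "subst h \<rho> p = (\<Sum>m\<in>M. h (Poly_Mapping.lookup p m) *
    (\<Prod>v\<in>Poly_Mapping.keys m. \<rho> v ^ Poly_Mapping.lookup m v))"
  unfolding subst_def using assms
  by (intro sum.mono_neutral_left) (auto simp: in_keys_iff)

lemma subst_0: "subst h \<rho> 0 = 0"
  by (simp add: subst_def)

lemma subst_add:
  assumes "semiring_hom h"
  shows "subst h \<rho> (p + q) = subst h \<rho> p + subst h \<rho> q"
proof -
  let ?M = "Poly_Mapping.keys p \<union> Poly_Mapping.keys q"
  have "Poly_Mapping.keys (p + q) \<subseteq> ?M" by (rule keys_add)
  then show ?thesis
    using assms
    by (simp add: subst_cover[where M = ?M] semiring_hom_0 semiring_hom_add lookup_add
        distrib_right sum.distrib)
qed

lemma subst_sum: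
  assumes "semiring_hom h"
  shows "subst h \<rho> (sum f A) = (\<Sum>a\<in>A. subst h \<rho> (f a))"
  by (induction A rule: infinite_finite_induct) (simp_all add: subst_0 subst_add[OF assms])

lemma subst_single:
  assumes "semiring_hom h"
  shows "subst h \<rho> (Poly_Mapping.single m c) =
    h c * (\<Prod>v\<in>Poly_Mapping.keys m. \<rho> v ^ Poly_Mapping.lookup m v)"
  using assms by (cases "c = 0") (simp_all add: subst_def semiring_hom_0)

text \<open>Evaluation of monomials turns sums of exponents into products, which makes \<open>subst\<close> multiplicative.\<close>

lemma monomial_add:
  fixes \<rho> :: "'v \<Rightarrow> 'a::comm_semiring_1"
  shows "(\<Prod>v\<in>Poly_Mapping.keys (m + n). \<rho> v ^ Poly_Mapping.lookup (m + n) v) =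
    (\<Prod>v\<in>Poly_Mapping.keys m. \<rho> v ^ Poly_Mapping.lookup m v) *
    (\<Prod>v\<in>Poly_Mapping.keys n. \<rho> v ^ Poly_Mapping.lookup n v)"
proof -
  let ?M = "Poly_Mapping.keys m \<union> Poly_Mapping.keys n"
  have cover: "(\<Prod>v\<in>Poly_Mapping.keys k. \<rho> v ^ Poly_Mapping.lookup k v) =
      (\<Prod>v\<in>?M. \<rho> v ^ Poly_Mapping.lookup k v)" if "Poly_Mapping.keys k \<subseteq> ?M" for k
    using that by (intro prod.mono_neutral_left) (auto simp: in_keys_iff)
  show ?thesis
    unfolding cover[OF keys_add] cover[OF Un_upper1] cover[OF Un_upper2]
    by (simp add: lookup_add power_add prod.distrib)
qed

lemma sum_of_singles: "(\<Sum>m\<in>Poly_Mapping.keys p. Poly_Mapping.single m (Poly_Mapping.lookup p m)) = p"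
  by (rule poly_mapping_eqI)
    (auto simp: lookup_sum lookup_single when_def in_keys_iff)

lemma subst_mult:
  assumes "semiring_hom h"
  shows "subst h \<rho> (p * q) = subst h \<rho> p * subst h \<rho> q"
proof -
  let ?s = "\<lambda>f m. Poly_Mapping.single m (Poly_Mapping.lookup f m)"
  have single: "subst h \<rho> (?s p m * ?s q n) = subst h \<rho> (?s p m) * subst h \<rho> (?s q n)" for m n
    by (simp add: mult_single subst_single[OF assms] monomial_add semiring_hom_mult[OF assms])
  have "subst h \<rho> (p * q) = subst h \<rho>
      ((\<Sum>m\<in>Poly_Mapping.keys p. ?s p m) * (\<Sum>n\<in>Poly_Mapping.keys q. ?s q n))"
    by (simp only: sum_of_singles)
  also have "\<dots> = subst h \<rho> (\<Sum>m\<in>Poly_Mapping.keys p. ?s p m) *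
      subst h \<rho> (\<Sum>n\<in>Poly_Mapping.keys q. ?s q n)"
    by (simp only: sum_product subst_sum[OF assms] single)
  finally show ?thesis by (simp only: sum_of_singles)
qed

lemma subst_const: "semiring_hom h \<Longrightarrow> subst h \<rho> (const c) = h c"
  by (simp add: const_def subst_single)

lemma subst_var: "semiring_hom h \<Longrightarrow> subst h \<rho> (var v) = \<rho> v"
  by (simp add: var_def subst_single semiring_hom_1)

lemma semiring_hom_subst:
  assumes "semiring_hom h"
  shows "semiring_hom (subst h \<rho>)"
proof -
  have "subst h \<rho> 1 = 1"
    using subst_single[OF assms, of \<rho> 0 1] by (simp add: semiring_hom_1[OF assms])
  then show ?thesis
    by (simp add: semiring_hom_def subst_0 subst_add[OF assms] subst_mult[OF assms])
qed

lemma subst_const_var: "subst const var p = p"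
proof -
  have var_power: "var v ^ n = Poly_Mapping.single (Poly_Mapping.single v n) 1" for v n
    by (induction n) (simp_all add: var_def mult_single single_add[symmetric])
  have monomial: "(\<Prod>v\<in>A. Poly_Mapping.single (f v) 1) =
      Poly_Mapping.single (\<Sum>v\<in>A. f v) (1::'a)" if "finite A"
    for A :: "(nat \<times> nat) set" and f :: "nat \<times> nat \<Rightarrow> ((nat \<times> nat) \<Rightarrow>\<^sub>0 nat)"
    using that by (induction A rule: finite_induct) (simp_all add: mult_single)
  show ?thesis
    by (simp add: subst_def var_power monomial sum_of_singles const_def mult_single)
qed


section \<open>Subrings of polynomials and their ideals\<close>

definition subring_set :: "'a::comm_ring_1 set \<Rightarrow> bool" where
  "subring_set B \<longleftrightarrow> 1 \<in> B \<and> (\<forall>a\<in>B. - a \<in> B) \<and> (\<forall>a\<in>B. \<forall>b\<in>B. a + b \<in> B \<and> a * b \<in> B)"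

lemma subring_set_1: "subring_set B \<Longrightarrow> 1 \<in> B"
  and subring_set_uminus: "subring_set B \<Longrightarrow> a \<in> B \<Longrightarrow> - a \<in> B"
  and subring_set_add: "subring_set B \<Longrightarrow> a \<in> B \<Longrightarrow> b \<in> B \<Longrightarrow> a + b \<in> B"
  and subring_set_mult: "subring_set B \<Longrightarrow> a \<in> B \<Longrightarrow> b \<in> B \<Longrightarrow> a * b \<in> B"
  by (simp_all add: subring_set_def)

lemma subring_set_0: "subring_set B \<Longrightarrow> 0 \<in> B"
  by (metis add.right_inverse subring_set_1 subring_set_add subring_set_uminus)

lemma subring_set_diff: "subring_set B \<Longrightarrow> a \<in> B \<Longrightarrow> b \<in> B \<Longrightarrow> a - b \<in> B"
  by (metis add_uminus_conv_diff subring_set_add subring_set_uminus)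

lemma subring_set_sum: "subring_set B \<Longrightarrow> (\<And>x. x \<in> A \<Longrightarrow> f x \<in> B) \<Longrightarrow> sum f A \<in> B"
  by (induction A rule: infinite_finite_induct) (auto simp: subring_set_0 subring_set_add)

lemma subring_set_prod: "subring_set B \<Longrightarrow> (\<And>x. x \<in> A \<Longrightarrow> f x \<in> B) \<Longrightarrow> prod f A \<in> B"
  by (induction A rule: infinite_finite_induct) (auto simp: subring_set_1 subring_set_mult)

lemma subring_set_power: "subring_set B \<Longrightarrow> a \<in> B \<Longrightarrow> a ^ n \<in> B"
  by (induction n) (auto simp: subring_set_1 subring_set_mult)

lemmas subring_set_intros = subring_set_0 subring_set_1 subring_set_uminus subring_set_add
  subring_set_mult subring_set_diff subring_set_sum subring_set_prod subring_set_power

lemma ring_on_simps: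
  "carrier (ring_on B) = B" "\<zero>\<^bsub>ring_on B\<^esub> = 0" "\<one>\<^bsub>ring_on B\<^esub> = 1"
  "x \<oplus>\<^bsub>ring_on B\<^esub> y = x + y" "x \<otimes>\<^bsub>ring_on B\<^esub> y = x * y"
  by (simp_all add: ring_on_def)

lemma ring_ring_on:
  assumes "subring_set B"
  shows "ring (ring_on B)"
proof (rule ringI)
  show "abelian_group (ring_on B)"
    by (rule abelian_groupI)
      (auto simp: ring_on_simps algebra_simps subring_set_0 subring_set_add assms
        intro: bexI[OF _ subring_set_uminus[OF assms]])
  show "monoid (ring_on B)"
    by (rule monoidI) (auto simp: ring_on_simps algebra_simps subring_set_1 subring_set_mult assms)
qed (auto simp: ring_on_simps algebra_simps)

lemma ideal_ring_on_iff:
  assumes "subring_set B"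
  shows "ideal I (ring_on B) \<longleftrightarrow>
    I \<subseteq> B \<and> 0 \<in> I \<and> (\<forall>x\<in>I. \<forall>y\<in>I. x + y \<in> I) \<and> (\<forall>b\<in>B. \<forall>x\<in>I. b * x \<in> I)"
    (is "_ \<longleftrightarrow> ?R")
proof
  assume I: "ideal I (ring_on B)"
  interpret ideal I "ring_on B" by fact
  have "I \<subseteq> B" using Icarr by (auto simp: ring_on_simps)
  then show ?R
    using additive_subgroup.zero_closed[OF additive_subgroup_axioms]
      additive_subgroup.a_closed[OF additive_subgroup_axioms] I_l_closed
    by (auto simp: ring_on_simps)
next
  assume R: ?R
  interpret ring "ring_on B" by (rule ring_ring_on[OF assms])
  have neg: "- x \<in> I" if "x \<in> I" for x
    using R that subring_set_uminus[OF assms subring_set_1[OF assms]] by fastforce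
  show "ideal I (ring_on B)"
  proof (rule idealI)
    show "subgroup I (add_monoid (ring_on B))"
    proof (rule add.subgroupI)
      fix a assume a: "a \<in> I"
      then have "\<ominus>\<^bsub>ring_on B\<^esub> a = - a"
        using R neg[OF a] by (intro minus_equality) (auto simp: ring_on_simps)
      then show "\<ominus>\<^bsub>ring_on B\<^esub> a \<in> I" using neg[OF a] by simp
    qed (use R in \<open>auto simp: ring_on_simps\<close>)
    show "a \<otimes>\<^bsub>ring_on B\<^esub> x \<in> I" if "x \<in> carrier (ring_on B)" "a \<in> I" for a x
      using R that by (metis mult.commute ring_on_simps(1,5))
  qed (use R in \<open>auto simp: ring_on_simps ring_axioms\<close>)
qed

lemma subring_polys_in: "subring_set (polys_in A :: 'k::field mpoly set)"
proof -
  have mult: "p * q \<in> polys_in A" if "p \<in> polys_in A" "q \<in> polys_in A" for p q :: "'k mpoly"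
    unfolding polys_in_def mem_Collect_eq
  proof
    fix k assume "k \<in> Poly_Mapping.keys (p * q)"
    then obtain m n where "k = m + n" "m \<in> Poly_Mapping.keys p" "n \<in> Poly_Mapping.keys q"
      using keys_mult[of p q] by blast
    then show "Poly_Mapping.keys k \<subseteq> A"
      using that keys_add[of m n] unfolding polys_in_def by blast
  qed
  have add: "p + q \<in> polys_in A" if "p \<in> polys_in A" "q \<in> polys_in A" for p q :: "'k mpoly"
    using that keys_add[of p q] unfolding polys_in_def by blast
  have "- p \<in> polys_in A" if "p \<in> polys_in A" for p :: "'k mpoly"
    using that by (simp add: polys_in_def in_keys_iff)
  moreover have "(1 :: 'k mpoly) \<in> polys_in A" by (simp add: polys_in_def)
  ultimately show ?thesis
    unfolding subring_set_def using mult add by blast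
qed

lemma const_in_polys_in: "const c \<in> polys_in A"
  by (simp add: polys_in_def const_def)

lemma var_in_polys_in: "v \<in> A \<Longrightarrow> var v \<in> polys_in A"
  by (simp add: polys_in_def var_def)

text \<open>
  As a ring, \<open>K[A]\<close> is generated by constants and variables.  Hence a homomorphism on it is determined by
  its values on these, its image lies in every subring containing these values, and elimination of
  variables can be done one generator at a time.
\<close>

lemma polys_in_induct [consumes 1, case_names const var add mult]:
  assumes "p \<in> polys_in A"
    and const: "\<And>c. P (const c)" and var: "\<And>v. v \<in> A \<Longrightarrow> P (var v)"
    and add: "\<And>p q. P p \<Longrightarrow> P q \<Longrightarrow> P (p + q)"
    and mult: "\<And>p q. P p \<Longrightarrow> P q \<Longrightarrow> P (p * q)"
  shows "P p"
proof -
  have "P 0" "P 1" using const[of 0] const[of 1] by (simp_all add: const_def)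
  have P_power: "P (q ^ n)" if "P q" for q n
    by (induction n) (auto simp: \<open>P 1\<close> intro: mult that)
  have P_prod: "P (prod f M)" if "\<And>m. m \<in> M \<Longrightarrow> P (f m)" for f and M :: "(nat \<times> nat) set"
    using that by (induction M rule: infinite_finite_induct) (auto simp: \<open>P 1\<close> intro: mult)
  have P_sum: "P (sum f M)" if "\<And>m. m \<in> M \<Longrightarrow> P (f m)" for f and M :: "((nat \<times> nat) \<Rightarrow>\<^sub>0 nat) set"
    using that by (induction M rule: infinite_finite_induct) (auto simp: \<open>P 0\<close> intro: add)
  have "P (subst const var p)"
    unfolding subst_def
  proof (intro P_sum mult const P_prod P_power var)
    fix m v assume "m \<in> Poly_Mapping.keys p" "v \<in> Poly_Mapping.keys m"
    then show "v \<in> A" using assms(1) by (auto simp: polys_in_def)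
  qed
  then show ?thesis by (simp only: subst_const_var)
qed


section \<open>Products of powers of binary forms\<close>

text \<open>
  The generic product of the \<open>G\<^sub>r ^ r\<close>, with its coefficients specialized to arbitrary values \<open>\<rho>\<close> in any
  commutative semiring.  All of \<open>\<Theta>\<^sub>j\<close>, \<open>\<theta>\<^sub>j\<close> and their images in fraction fields are
  coefficients of instances of it.
\<close>

definition power_product ::
  "nat \<Rightarrow> (nat \<Rightarrow> nat) \<Rightarrow> (nat \<times> nat \<Rightarrow> 'a::comm_semiring_1) \<Rightarrow> 'a poly poly" where
  "power_product d e \<rho> = (\<Prod>r=1..d. (\<Sum>t=0..e r. monom (monom (\<rho> (r, t)) t) (e r - t)) ^ r)"

lemma coeff_form:
  "coeff (coeff (\<Sum>t=0..n. monom (monom (c t) t) (n - t)) i) j = (if i + j = n then c j else 0)"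
proof -
  have "coeff (coeff (\<Sum>t=0..n. monom (monom (c t) t) (n - t)) i) j =
      (\<Sum>t=0..n. if t = j then (if i + j = n then c j else 0) else 0)"
    unfolding coeff_sum by (intro sum.cong) auto
  then show ?thesis by (auto simp: sum.delta)
qed

lemma coeff_coeff_mult:
  "coeff (coeff (P * Q) i) j =
    (\<Sum>a\<le>i. \<Sum>b\<le>j. coeff (coeff P a) b * coeff (coeff Q (i - a)) (j - b))"
  by (simp add: coeff_mult coeff_sum)

text \<open>
  Graded induction: the index \<open>n\<close> in \<open>R n P\<close> tracks the degree of the form \<open>P\<close>.
\<close>

lemma power_product_induct [case_names form one mult]:
  assumes form: "\<And>r. 1 \<le> r \<Longrightarrow> r \<le> d \<Longrightarrow>
      R (e r) (\<Sum>t=0..e r. monom (monom (\<rho> (r, t)) t) (e r - t))"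
    and one: "R 0 1"
    and mult: "\<And>m n P Q. R m P \<Longrightarrow> R n Q \<Longrightarrow> R (m + n) (P * Q)"
  shows "R (\<Sum>r=1..d. r * e r) (power_product d e \<rho>)"
proof -
  have power: "R (r * n) (P ^ r)" if "R n P" for r n P
    by (induction r) (auto intro: one mult that)
  have "R (\<Sum>r\<in>A. r * e r) (\<Prod>r\<in>A. (\<Sum>t=0..e r. monom (monom (\<rho> (r, t)) t) (e r - t)) ^ r)"
    if "finite A" "A \<subseteq> {1..d}" for A
    using that by (induction A rule: finite_induct) (auto intro!: one mult power form)
  from this[of "{1..d}"] show ?thesis by (simp add: power_product_def)
qed

text \<open>
  Taking coefficients of the product is natural in the coefficient ring.  This single fact replaces all
  computations with substitutions in \<open>\<Theta>\<^sub>j\<close>.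
\<close>

lemma coeff_power_product_hom:
  assumes \<sigma>: "semiring_hom \<sigma>"
  shows "\<sigma> (coeff (coeff (power_product d e \<rho>) i) j) =
    coeff (coeff (power_product d e (\<lambda>v. \<sigma> (\<rho> v))) i) j"
proof -
  define R where "R = (\<lambda>P Q. \<forall>i j. \<sigma> (coeff (coeff P i) j) = coeff (coeff Q i) j)"
  have one: "R 1 1" by (simp add: R_def coeff_1 semiring_hom_simps[OF \<sigma>])
  have mult: "R (P * P') (Q * Q')" if "R P Q" "R P' Q'" for P P' Q Q'
    using that
    by (simp add: R_def coeff_coeff_mult semiring_hom_sum[OF \<sigma>] semiring_hom_mult[OF \<sigma>])
  have form: "R (\<Sum>t=0..n. monom (monom (c t) t) (n - t))
      (\<Sum>t=0..n. monom (monom (\<sigma> (c t)) t) (n - t))" for n c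
    by (simp add: R_def coeff_form semiring_hom_0[OF \<sigma>])
  have power: "R (P ^ r) (Q ^ r)" if "R P Q" for P Q r
    by (induction r) (auto intro: one mult that)
  have prod: "R (\<Prod>r\<in>A. f r) (\<Prod>r\<in>A. g r)" if "\<And>r. R (f r) (g r)" for A :: "nat set" and f g
    by (induction A rule: infinite_finite_induct) (auto intro: one mult that)
  have "R (power_product d e \<rho>) (power_product d e (\<lambda>v. \<sigma> (\<rho> v)))"
    unfolding power_product_def by (intro prod power form)
  then show ?thesis by (simp add: R_def)
qed

text \<open>
  The coefficients of \<open>\<Prod>r. G\<^sub>r ^ r\<close> are homogeneous of degree \<open>r\<close> in the coefficients of \<open>G\<^sub>r\<close>; this produces the
  transition factors between charts.
\<close>

lemma coeff_power_product_scale: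
  "coeff (coeff (power_product d e (\<lambda>(r, t). c r * \<rho> (r, t))) i) j =
    (\<Prod>r=1..d. c r ^ r) * coeff (coeff (power_product d e \<rho>) i) j"
proof -
  let ?K = "\<lambda>a. [:[:a:]:]"
  have K: "semiring_hom ?K" by (simp add: semiring_hom_def one_pCons)
  have "(\<Sum>t=0..e r. monom (monom (c r * \<rho> (r, t)) t) (e r - t)) =
      ?K (c r) * (\<Sum>t=0..e r. monom (monom (\<rho> (r, t)) t) (e r - t))" for r
    by (simp add: sum_distrib_left smult_monom)
  then have "power_product d e (\<lambda>(r, t). c r * \<rho> (r, t)) =
      ?K (\<Prod>r=1..d. c r ^ r) * power_product d e \<rho>"
    unfolding power_product_def
    by (simp only: power_mult_distrib prod.distrib semiring_hom_prod[OF K] semiring_hom_power[OF K] prod.case)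
  then show ?thesis by simp
qed

lemma coeff_power_product_in_subring:
  assumes B: "subring_set B" and \<rho>: "\<And>r t. 1 \<le> r \<Longrightarrow> r \<le> d \<Longrightarrow> t \<le> e r \<Longrightarrow> \<rho> (r, t) \<in> B"
  shows "coeff (coeff (power_product d e \<rho>) i) j \<in> B"
proof -
  have "\<forall>i j. coeff (coeff (power_product d e \<rho>) i) j \<in> B"
    by (rule power_product_induct[where R = "\<lambda>_ P. \<forall>i j. coeff (coeff P i) j \<in> B" and e = e])
      (auto simp: coeff_form coeff_1 coeff_coeff_mult intro!: subring_set_intros[OF B] \<rho>)
  then show ?thesis by blast
qed

lemma homog_power_product: "homog (\<Sum>r=1..d. r * e r) (power_product d e \<rho>)"
  by (rule power_product_induct) (auto intro: homog_form homog_1 homog_mult)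

text \<open>
  With all coefficients equal to \<open>1\<close> nothing can cancel over the natural numbers.  This witnesses
  that no \<open>\<theta>\<^sub>j\<close> is the zero polynomial in characteristic zero.
\<close>

lemma coeff_power_product_ones_pos:
  assumes "i + j = (\<Sum>r=1..d. r * e r)"
  shows "coeff (coeff (power_product d e (\<lambda>_. 1 :: nat)) i) j > 0"
proof -
  let ?R = "\<lambda>n P. \<forall>i j. i + j = n \<longrightarrow> coeff (coeff P i) j > (0 :: nat)"
  have "?R (\<Sum>r=1..d. r * e r) (power_product d e (\<lambda>_. 1))"
  proof (rule power_product_induct[where R = ?R], goal_cases)
    case (3 m n P Q)
    show ?case
    proof (intro allI impI)
      fix i j assume ij: "i + j = m + n"
      \<comment> \<open>Any split of the bidegree \<open>(i, j)\<close> into bidegrees of total degree \<open>m\<close> and \<open>n\<close> will do.\<close>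
      define a where "a = min i m"
      have "a + (m - a) = m" "a \<le> i" "m - a \<le> j" "(i - a) + (j - (m - a)) = n"
        using ij by (auto simp: a_def)
      then have "0 < coeff (coeff P a) (m - a) * coeff (coeff Q (i - a)) (j - (m - a))"
        using 3 by simp
      also have "\<dots> \<le> (\<Sum>b\<le>j. coeff (coeff P a) b * coeff (coeff Q (i - a)) (j - b))"
        using \<open>m - a \<le> j\<close> by (intro member_le_sum) auto
      also have "\<dots> \<le> coeff (coeff (P * Q) i) j"
        unfolding coeff_coeff_mult using \<open>a \<le> i\<close>
        by (intro member_le_sum[where f = "\<lambda>a. \<Sum>b\<le>j. coeff (coeff P a) b * coeff (coeff Q (i - a)) (j - b)"]) auto
      finally show "coeff (coeff (P * Q) i) j > 0" .
    qed
  qed (auto simp: coeff_form)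
  then show ?thesis using assms by blast
qed


section \<open>McCoy's theorem and the content of a product\<close>

text \<open>
  Over the quotient by \<open>J\<close>, this is McCoy's theorem that a zero divisor \<open>g\<close> is annihilated by a
  nonzero scalar.  If \<open>f g\<close> vanishes, then each product \<open>g\<^sub>k f\<close> vanishes: going down from the top
  coefficient of \<open>g\<close>, the vanishing of \<open>g\<^sub>l f\<close> for \<open>l > k\<close> shows that \<open>g\<^sub>k f\<close> loses its leading
  coefficient, so \<open>g\<^sub>k f\<close> is a multiple of \<open>f\<close> of lower degree which is still annihilated by \<open>g\<close>,
  and induction on the degree of \<open>f\<close> applies.  Regularity of \<open>g\<^sub>b\<close> then forces \<open>f = 0\<close>.  The set \<open>J\<close>
  is merely asked to be stable under the coefficients of \<open>g\<close>, so that ideals of subrings are covered.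
\<close>

lemma mccoy_cancel:
  fixes f g :: "'a::comm_ring_1 poly"
  assumes J0: "0 \<in> J" and Jdiff: "\<And>a b. a \<in> J \<Longrightarrow> b \<in> J \<Longrightarrow> a - b \<in> J"
    and Jmult: "\<And>a k. a \<in> J \<Longrightarrow> coeff g k * a \<in> J"
    and regular: "\<And>a. coeff g b * a \<in> J \<Longrightarrow> a \<in> J"
    and fg: "\<And>i. coeff (f * g) i \<in> J"
  shows "coeff f i \<in> J"
proof -
  have Jadd: "a + b \<in> J" if "a \<in> J" "b \<in> J" for a b
    using Jdiff[OF that(1) Jdiff[OF J0 that(2)]] by simp
  have Jsum: "sum h A \<in> J" if "\<And>x. x \<in> A \<Longrightarrow> h x \<in> J" for h and A :: "nat set"
    using that by (induction A rule: infinite_finite_induct) (auto simp: J0 Jadd)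
  have "\<forall>i. coeff f i \<in> J" if "\<And>i. i \<ge> n \<Longrightarrow> coeff f i = 0" "\<And>i. coeff (f * g) i \<in> J" for n f
    using that
  proof (induction n arbitrary: f)
    case 0
    then show ?case by (simp add: J0)
  next
    case (Suc n)
    note f_top = Suc.prems(1) and fg_J = Suc.prems(2) and lower_degree = Suc.IH
    \<comment> \<open>Descending induction on \<open>k\<close>: \<open>m\<close> counts the steps down from \<open>degree g + 1\<close>.\<close>
    have gf: "\<forall>k. k + m > degree g \<longrightarrow> (\<forall>i. coeff g k * coeff f i \<in> J)" for m
    proof (induction m)
      case 0
      then show ?case by (simp add: coeff_eq_0 J0)
    next
      case (Suc m)
      show ?case
      proof (intro allI impI)
        fix k i assume k: "k + Suc m > degree g"
        have summand: "coeff f a * coeff g (n + k - a) \<in> J" if "a \<noteq> n" for a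
        proof (cases "a < n")
          case True
          then have "n + k - a + m > degree g" using k by simp
          then show ?thesis using Suc.IH by (metis mult.commute)
        next
          case False
          then show ?thesis using that by (simp add: f_top J0)
        qed
        have "coeff (f * g) (n + k) =
            coeff f n * coeff g k + (\<Sum>a\<in>{..n + k} - {n}. coeff f a * coeff g (n + k - a))"
          unfolding coeff_mult by (subst sum.remove[of _ n]) auto
        moreover have "(\<Sum>a\<in>{..n + k} - {n}. coeff f a * coeff g (n + k - a)) \<in> J"
          by (rule Jsum) (auto intro: summand)
        ultimately have "coeff f n * coeff g k \<in> J"
          using Jdiff[OF fg_J[of "n + k"]] by fastforce
        then have top: "coeff g k * coeff f n \<in> J" by (simp add: mult.commute)
        \<comment> \<open>\<open>f'\<close> is \<open>g\<^sub>k f\<close> without its leading term, which lies in \<open>J\<close> already.\<close>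
        define f' where "f' = smult (coeff g k) f - monom (coeff g k * coeff f n) n"
        have "\<forall>i. coeff f' i \<in> J"
        proof (rule lower_degree)
          show "coeff f' i = 0" if "n \<le> i" for i
            using that by (cases "i = n") (auto simp: f'_def f_top)
          have "f' * g = smult (coeff g k) (f * g) - monom (coeff g k * coeff f n) n * g"
            by (simp add: f'_def left_diff_distrib)
          then have "coeff (f' * g) i = coeff g k * coeff (f * g) i -
              (if i < n then 0 else (coeff g k * coeff f n) * coeff g (i - n))" for i
            by (simp add: coeff_monom_mult)
          moreover have "(coeff g k * coeff f n) * coeff g l \<in> J" for l
            by (subst mult.commute) (rule Jmult[OF top])
          ultimately show "coeff (f' * g) i \<in> J" for i
            by (cases "i < n") (simp_all add: Jdiff Jmult fg_J J0)
        qed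
        then have "coeff f' i + (if i = n then coeff g k * coeff f n else 0) \<in> J"
          by (intro Jadd) (auto simp: top J0)
        then show "coeff g k * coeff f i \<in> J"
          by (auto simp: f'_def split: if_splits)
      qed
    qed
    show ?case using gf[of "Suc (degree g)"] regular by simp
  qed
  from this[of "Suc (degree f)" f] show ?thesis using fg by (simp add: coeff_eq_0)
qed

text \<open>
  Binary forms are polynomials in \<open>x\<close> over \<open>R[y]\<close>, so McCoy's argument is applied to \<open>J[y]\<close> in place
  of \<open>J\<close>.  The normalized coefficient of \<open>G\<^sub>r\<close> is then the monomial \<open>y ^ \<alpha> r\<close>, no unit, but regular modulo
  \<open>J[y]\<close>.  Cancelling the factors of the product one after the other leaves the form \<open>1\<close>.
\<close>

lemma power_product_unit_content:
  fixes \<rho> :: "nat \<times> nat \<Rightarrow> 'a::comm_ring_1"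
  assumes J0: "0 \<in> J" and Jdiff: "\<And>a b. a \<in> J \<Longrightarrow> b \<in> J \<Longrightarrow> a - b \<in> J"
    and Jmult: "\<And>a r t. 1 \<le> r \<Longrightarrow> r \<le> d \<Longrightarrow> t \<le> e r \<Longrightarrow> a \<in> J \<Longrightarrow> \<rho> (r, t) * a \<in> J"
    and normalized: "\<And>r. 1 \<le> r \<Longrightarrow> r \<le> d \<Longrightarrow> \<alpha> r \<le> e r \<and> \<rho> (r, \<alpha> r) = 1"
    and coeffs: "\<And>i j. coeff (coeff (power_product d e \<rho>) i) j \<in> J"
  shows "1 \<in> J"
proof -
  define J' where "J' = {p. \<forall>j. coeff p j \<in> J}"
  define G where "G = (\<lambda>r. \<Sum>t=0..e r. monom (monom (\<rho> (r, t)) t) (e r - t))"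
  have coeff_G: "coeff (G r) k = (if k \<le> e r then monom (\<rho> (r, e r - k)) (e r - k) else 0)" for r k
    by (rule poly_eqI) (auto simp: G_def coeff_form)
  have G_cancel: "\<forall>i. coeff P i \<in> J'" if r: "1 \<le> r" "r \<le> d" and PG: "\<forall>i. coeff (P * G r) i \<in> J'" for P r
  proof
    fix i
    show "coeff P i \<in> J'"
    proof (rule mccoy_cancel[where g = "G r" and b = "e r - \<alpha> r"])
      show "0 \<in> J'" "\<And>a b. a \<in> J' \<Longrightarrow> b \<in> J' \<Longrightarrow> a - b \<in> J'"
        by (auto simp: J'_def J0 Jdiff)
      show "coeff (G r) k * a \<in> J'" if "a \<in> J'" for a k
        using that r unfolding coeff_G by (auto simp: J'_def coeff_monom_mult J0 intro!: Jmult)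
      show "a \<in> J'" if "coeff (G r) (e r - \<alpha> r) * a \<in> J'" for a
      proof -
        have "coeff (monom 1 (\<alpha> r) * a) (\<alpha> r + j) \<in> J" for j
          using that normalized[OF r] unfolding coeff_G J'_def by simp
        then show ?thesis by (simp add: J'_def coeff_monom_mult)
      qed
    qed (use PG in auto)
  qed
  have power_cancel: "\<forall>i. coeff P i \<in> J'"
    if r: "1 \<le> r" "r \<le> d" and "\<forall>i. coeff (P * G r ^ n) i \<in> J'" for P r n
    using that(3)
  proof (induction n arbitrary: P)
    case (Suc n)
    have "P * G r ^ Suc n = (P * G r ^ n) * G r" by (simp add: mult_ac)
    from Suc.prems[unfolded this] have "\<forall>i. coeff ((P * G r ^ n) * G r) i \<in> J'" .
    then show ?case by (rule Suc.IH[OF G_cancel[OF r]])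
  qed simp
  have prod_cancel: "\<forall>i. coeff P i \<in> J'"
    if "finite A" "A \<subseteq> {1..d}" "\<forall>i. coeff (P * (\<Prod>r\<in>A. G r ^ r)) i \<in> J'" for P A
    using that
  proof (induction A arbitrary: P rule: finite_induct)
    case (insert r A)
    have "P * (\<Prod>r\<in>insert r A. G r ^ r) = (P * G r ^ r) * (\<Prod>r\<in>A. G r ^ r)"
      using insert.hyps by (simp add: mult_ac)
    from insert.prems(2)[unfolded this]
    have "\<forall>i. coeff ((P * G r ^ r) * (\<Prod>r\<in>A. G r ^ r)) i \<in> J'" .
    with insert.IH insert.prems(1) have "\<forall>i. coeff (P * G r ^ r) i \<in> J'" by blast
    then show ?case using insert.prems(1) power_cancel[of r P r] by simp
  qed simp
  have "\<forall>i. coeff 1 i \<in> J'"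
    by (rule prod_cancel[of "{1..d}"])
      (use coeffs in \<open>simp_all add: J'_def power_product_def G_def\<close>)
  then have "coeff (coeff (1 :: 'a poly poly) 0) 0 \<in> J" unfolding J'_def by blast
  then show ?thesis by simp
qed


section \<open>The matrix on one chart\<close>

abbreviation chart_vars :: "nat \<Rightarrow> (nat \<Rightarrow> nat) \<Rightarrow> (nat \<Rightarrow> nat) \<Rightarrow> (nat \<times> nat) set" where
  "chart_vars d e \<alpha> \<equiv> {(r, t). r \<le> d \<and> t \<le> e r \<and> t \<noteq> \<alpha> r}"

abbreviation param_vars :: "nat \<Rightarrow> (nat \<Rightarrow> nat) \<Rightarrow> (nat \<Rightarrow> nat) \<Rightarrow> (nat \<times> nat) set" where
  "param_vars d e \<alpha> \<equiv> {(r, t). 1 \<le> r \<and> r \<le> d \<and> t \<le> e r \<and> t \<noteq> \<alpha> r}"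

lemma carrier_chart_ring: "carrier (chart_ring d e \<alpha>) = polys_in (chart_vars d e \<alpha>)"
  by (simp add: chart_ring_def ring_on_simps)

lemma param_polys_subset_chart: "polys_in (param_vars d e \<alpha>) \<subseteq> polys_in (chart_vars d e \<alpha>)"
  by (auto simp: polys_in_def)

lemma Lambda_le: "\<alpha> \<in> Lambda d e \<Longrightarrow> r \<le> d \<Longrightarrow> \<alpha> r \<le> e r"
  unfolding Lambda_def by (auto dest: PiE_mem)

lemma coord_normalized: "coord \<alpha> (r, \<alpha> r) = 1"
  by (simp add: coord_def)

lemma coord_in_chart: "r \<le> d \<Longrightarrow> t \<le> e r \<Longrightarrow> coord \<alpha> (r, t) \<in> polys_in (chart_vars d e \<alpha>)"
  by (auto simp: coord_def intro: var_in_polys_in subring_set_1[OF subring_polys_in])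

lemma generic_product_eq_power_product: "generic_product d e = power_product d e var"
  by (simp add: generic_product_def power_product_def)

lemma theta_eq: "theta d e \<alpha> j = coeff (coeff (power_product d e (coord \<alpha>)) (d - j)) j"
proof -
  note hom = semiring_hom_subst[OF semiring_hom_const]
  show ?thesis
    unfolding theta_def Theta_def generic_product_eq_power_product
    by (simp add: coeff_power_product_hom[OF hom] subst_var[OF semiring_hom_const])
qed

lemma theta_in_param_polys: "theta d e \<alpha> j \<in> polys_in (param_vars d e \<alpha>)"
  unfolding theta_eq
  by (rule coeff_power_product_in_subring[OF subring_polys_in])
    (auto simp: coord_def intro: var_in_polys_in subring_set_1[OF subring_polys_in])

lemma theta_in_chart: "theta d e \<alpha> j \<in> polys_in (chart_vars d e \<alpha>)"
  using theta_in_param_polys param_polys_subset_chart by blast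

text \<open>Evaluation at the point all of whose coordinates are \<open>1\<close> gives a positive integer.\<close>

lemma theta_nonzero:
  assumes "(\<Sum>r=1..d. r * e r) = d" "j \<le> d"
  shows "(theta d e \<alpha> j :: 'k::field_char_0 mpoly) \<noteq> 0"
proof
  let ?ev = "subst (\<lambda>c. c) (\<lambda>_. 1) :: 'k mpoly \<Rightarrow> 'k"
  have ev: "semiring_hom ?ev" by (rule semiring_hom_subst[OF semiring_hom_id])
  have "?ev (coord \<alpha> v) = 1" for v
    by (cases v) (simp add: coord_def semiring_hom_1[OF ev] subst_var[OF semiring_hom_id])
  then have "?ev (theta d e \<alpha> j) = coeff (coeff (power_product d e (\<lambda>_. 1)) (d - j)) j"
    by (simp add: theta_eq coeff_power_product_hom[OF ev])
  also have "\<dots> = of_nat (coeff (coeff (power_product d e (\<lambda>_. 1)) (d - j)) j)"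
    by (simp add: coeff_power_product_hom[OF semiring_hom_of_nat])
  also have "\<dots> \<noteq> 0"
    using coeff_power_product_ones_pos[where i = "d - j" and j = j and d = d and e = e] assms by simp
  finally have "?ev (theta d e \<alpha> j) \<noteq> 0" .
  moreover assume "theta d e \<alpha> j = (0 :: 'k mpoly)"
  ultimately show False by (simp add: subst_0)
qed

lemma minors2_phi:
  "minors2 d (phi d e \<alpha>) =
    {theta d e \<alpha> i * coord \<alpha> (0, j) - theta d e \<alpha> j * coord \<alpha> (0, i) | i j. i < j \<and> j \<le> d}"
  by (simp add: minors2_def phi_def)

lemma minors_in_chart:
  assumes "e 0 = d"
  shows "minors2 d (phi d e \<alpha>) \<subseteq> polys_in (chart_vars d e \<alpha>)"
  unfolding minors2_phi using assms
  by (auto intro!: subring_set_intros[OF subring_polys_in] theta_in_chart coord_in_chart)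

lemma ideal_chart_iff:
  "ideal I (chart_ring d e \<alpha>) \<longleftrightarrow> I \<subseteq> polys_in (chart_vars d e \<alpha>) \<and> 0 \<in> I \<and>
    (\<forall>x\<in>I. \<forall>y\<in>I. x + y \<in> I) \<and> (\<forall>b\<in>polys_in (chart_vars d e \<alpha>). \<forall>x\<in>I. b * x \<in> I)"
  unfolding chart_ring_def by (rule ideal_ring_on_iff[OF subring_polys_in])

text \<open>
  These are up to sign the minors with the column \<open>\<alpha> 0\<close>, whose lower entry is \<open>1\<close>; the sign depends on
  the side of that column on which \<open>j\<close> lies.
\<close>

lemma theta_minus_coord_theta_in_ideal:
  assumes I: "ideal I (chart_ring d e \<alpha>)" and minors: "minors2 d (phi d e \<alpha>) \<subseteq> I"
    and \<alpha>: "\<alpha> 0 \<le> d" and j: "j \<le> d"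
  shows "theta d e \<alpha> j - coord \<alpha> (0, j) * theta d e \<alpha> (\<alpha> 0) \<in> I"
proof -
  let ?m = "\<lambda>i j. theta d e \<alpha> i * coord \<alpha> (0, j) - theta d e \<alpha> j * coord \<alpha> (0, i)"
  note closed = I[unfolded ideal_chart_iff]
  consider "j < \<alpha> 0" | "j = \<alpha> 0" | "j > \<alpha> 0" by linarith
  then show ?thesis
  proof cases
    case 1
    then have "?m j (\<alpha> 0) \<in> I" using minors \<alpha> unfolding minors2_phi by blast
    then show ?thesis by (simp add: coord_normalized mult.commute)
  next
    case 2
    then show ?thesis using closed by (simp add: coord_normalized)
  next
    case 3
    then have "?m (\<alpha> 0) j \<in> I" using minors j unfolding minors2_phi by blast
    moreover have "- 1 \<in> polys_in (chart_vars d e \<alpha>)"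
      by (intro subring_set_intros[OF subring_polys_in])
    ultimately have "- 1 * ?m (\<alpha> 0) j \<in> I" using closed by blast
    then show ?thesis by (simp add: coord_normalized mult.commute)
  qed
qed

text \<open>
  The geometric content is that \<open>T_\<phi>\<close> lies over the open set where \<open>\<theta>_{\<alpha> 0}\<close> is invertible: where \<open>\<theta>_{\<alpha> 0}\<close>
  vanishes on \<open>T_\<phi>\<close>, all \<open>\<theta>\<^sub>j\<close> vanish, which is impossible for a product of nonzero forms.
\<close>

lemma theta_invertible_mod_minors:
  assumes I: "ideal I (chart_ring d e \<alpha> :: 'k::field mpoly ring)" and minors: "minors2 d (phi d e \<alpha>) \<subseteq> I"
    and \<alpha>: "\<alpha> \<in> Lambda d e" and e0: "e 0 = d" and part: "(\<Sum>r=1..d. r * e r) = d"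
  obtains u where "u \<in> polys_in (chart_vars d e \<alpha>)" "1 - u * theta d e \<alpha> (\<alpha> 0) \<in> I"
proof -
  let ?B = "polys_in (chart_vars d e \<alpha>)" and ?\<theta> = "theta d e \<alpha>"
  \<comment> \<open>\<open>J\<close> consists of the \<open>p\<close> which become multiples of \<open>\<theta>_{\<alpha> 0}\<close> modulo \<open>I\<close>.\<close>
  define J where "J = {p. \<exists>u\<in>?B. p - u * ?\<theta> (\<alpha> 0) \<in> I}"
  note closed = I[unfolded ideal_chart_iff]
  note B = subring_set_intros[OF subring_polys_in]
  have Iadd: "x + y \<in> I" if "x \<in> I" "y \<in> I" for x y using closed that by blast
  have Imult: "b * x \<in> I" if "b \<in> ?B" "x \<in> I" for b x using closed that by blast
  have Idiff: "x - y \<in> I" if "x \<in> I" "y \<in> I" for x y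
    using Iadd[OF that(1) Imult[OF _ that(2), of "- 1"]] by (simp add: B(2,3))
  have J0: "0 \<in> J"
    unfolding J_def using closed B(1) by (auto intro!: bexI[of _ 0])
  have "1 \<in> J"
  proof (rule power_product_unit_content)
    show "0 \<in> J" by (rule J0)
    show "a - b \<in> J" if "a \<in> J" "b \<in> J" for a b
    proof -
      from that obtain u v where "u \<in> ?B" "v \<in> ?B"
        "a - u * ?\<theta> (\<alpha> 0) \<in> I" "b - v * ?\<theta> (\<alpha> 0) \<in> I" unfolding J_def by blast
      moreover from this have "(a - b) - (u - v) * ?\<theta> (\<alpha> 0) \<in> I"
        using Idiff[of "a - u * ?\<theta> (\<alpha> 0)" "b - v * ?\<theta> (\<alpha> 0)"] by (simp add: algebra_simps)
      moreover have "u - v \<in> ?B" using \<open>u \<in> ?B\<close> \<open>v \<in> ?B\<close> by (rule B(6))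
      ultimately show ?thesis unfolding J_def by blast
    qed
    show "coord \<alpha> (r, t) * a \<in> J" if "r \<le> d" "t \<le> e r" "a \<in> J" for a r t
    proof -
      from that obtain u where "u \<in> ?B" "a - u * ?\<theta> (\<alpha> 0) \<in> I" unfolding J_def by blast
      moreover have c: "coord \<alpha> (r, t) \<in> ?B" using that(1,2) by (rule coord_in_chart)
      ultimately have "coord \<alpha> (r, t) * a - (coord \<alpha> (r, t) * u) * ?\<theta> (\<alpha> 0) \<in> I"
        using Imult[of "coord \<alpha> (r, t)" "a - u * ?\<theta> (\<alpha> 0)"] by (simp add: algebra_simps)
      moreover have "coord \<alpha> (r, t) * u \<in> ?B" using c \<open>u \<in> ?B\<close> by (rule B(5))
      ultimately show ?thesis unfolding J_def by blast
    qed
    show "\<alpha> r \<le> e r \<and> coord \<alpha> (r, \<alpha> r) = 1" if "r \<le> d" for r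
      using Lambda_le[OF \<alpha> that] by (simp add: coord_normalized)
    show "coeff (coeff (power_product d e (coord \<alpha>)) i) j \<in> J" for i j
    proof (cases "i + j = d")
      case True
      then have "i = d - j" "j \<le> d" by auto
      moreover have "?\<theta> j \<in> J"
        using theta_minus_coord_theta_in_ideal[OF I minors _ \<open>j \<le> d\<close>] Lambda_le[OF \<alpha>, of 0]
          coord_in_chart[of 0 d j e \<alpha>] \<open>j \<le> d\<close> e0 unfolding J_def by auto
      ultimately show ?thesis by (simp add: theta_eq)
    next
      case False
      then have "coeff (coeff (power_product d e (coord \<alpha>)) i) j = (0 :: 'k mpoly)"
        using homog_power_product[where d = d and e = e and \<rho> = "coord \<alpha>"]
        unfolding homog_def part by blast
      then show ?thesis by (simp only: J0)
    qed
  qed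
  then show ?thesis using that unfolding J_def by blast
qed


section \<open>The comorphism of the graph\<close>

lemma semiring_hom_graph_comorphism: "semiring_hom (graph_comorphism d e \<alpha>)"
  unfolding graph_comorphism_def by (rule semiring_hom_subst[OF semiring_hom_frac_const])

lemma graph_comorphism_const: "graph_comorphism d e \<alpha> (const c) = frac (const c)"
  unfolding graph_comorphism_def by (rule subst_const[OF semiring_hom_frac_const])

lemma graph_comorphism_var:
  "graph_comorphism d e \<alpha> (var (r, t)) =
    (if r = 0 then frac (theta d e \<alpha> t) / frac (theta d e \<alpha> (\<alpha> 0)) else frac (coord \<alpha> (r, t)))"
  unfolding graph_comorphism_def by (simp add: subst_var[OF semiring_hom_frac_const])

lemma graph_comorphism_param:
  assumes "p \<in> polys_in (param_vars d e \<alpha>)"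
  shows "graph_comorphism d e \<alpha> p = frac p"
  using assms
proof (induction rule: polys_in_induct)
  case (var v)
  then show ?case by (auto simp: graph_comorphism_var coord_def)
qed (simp_all only: graph_comorphism_const semiring_hom_simps[OF semiring_hom_graph_comorphism]
    semiring_hom_simps[OF semiring_hom_frac])

lemma graph_comorphism_coord_0:
  assumes "theta d e \<alpha> (\<alpha> 0) \<noteq> (0 :: 'k::field mpoly)"
  shows "graph_comorphism d e \<alpha> (coord \<alpha> (0, j) :: 'k mpoly) =
    frac (theta d e \<alpha> j) / frac (theta d e \<alpha> (\<alpha> 0))"
  using assms
  by (simp add: coord_def graph_comorphism_var semiring_hom_1[OF semiring_hom_graph_comorphism]
      frac_eq_0_iff del: divide_fract)

lemma mem_graph_kernel_iff:
  "p \<in> a_kernel (chart_ring d e \<alpha>) (graph_preimage_ring d e \<alpha>) (graph_comorphism d e \<alpha>) \<longleftrightarrow>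
    p \<in> polys_in (chart_vars d e \<alpha>) \<and> graph_comorphism d e \<alpha> p = 0"
  by (simp add: a_kernel_def' carrier_chart_ring graph_preimage_ring_def ring_on_simps)

lemma ideal_graph_kernel:
  "ideal (a_kernel (chart_ring d e \<alpha>) (graph_preimage_ring d e \<alpha>) (graph_comorphism d e \<alpha>))
    (chart_ring d e \<alpha>)"
  unfolding ideal_chart_iff
  by (auto simp: mem_graph_kernel_iff semiring_hom_simps[OF semiring_hom_graph_comorphism]
      intro!: subring_set_intros[OF subring_polys_in])

lemma minors_in_graph_kernel:
  assumes "e 0 = d" "theta d e \<alpha> (\<alpha> 0) \<noteq> (0 :: 'k::field mpoly)"
  shows "minors2 d (phi d e \<alpha> :: _ \<Rightarrow> _ \<Rightarrow> 'k mpoly) \<subseteq>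
    a_kernel (chart_ring d e \<alpha>) (graph_preimage_ring d e \<alpha>) (graph_comorphism d e \<alpha>)"
proof
  fix p :: "'k mpoly" assume p: "p \<in> minors2 d (phi d e \<alpha>)"
  then obtain i j where "p = theta d e \<alpha> i * coord \<alpha> (0, j) - theta d e \<alpha> j * coord \<alpha> (0, i)"
    unfolding minors2_phi by blast
  then have "graph_comorphism d e \<alpha> p = 0"
    by (simp add: semiring_hom_diff[OF semiring_hom_graph_comorphism] assms(2)
        semiring_hom_mult[OF semiring_hom_graph_comorphism] graph_comorphism_coord_0
        graph_comorphism_param[OF theta_in_param_polys] mult.commute del: divide_fract mult_fract)
  then show "p \<in> a_kernel (chart_ring d e \<alpha>) (graph_preimage_ring d e \<alpha>) (graph_comorphism d e \<alpha>)"
    using minors_in_chart[of e d \<alpha>] assms(1) p by (auto simp: mem_graph_kernel_iff)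
qed

text \<open>
  Elimination of the \<open>z\<^sub>j\<close>: multiplying by \<open>\<theta>_{\<alpha> 0}\<close> allows each occurrence of \<open>z\<^sub>j\<close> to be replaced by \<open>\<theta>\<^sub>j\<close>.
\<close>

lemma chart_poly_reduces_to_param:
  assumes I: "ideal I (chart_ring d e \<alpha>)" and minors: "minors2 d (phi d e \<alpha>) \<subseteq> I"
    and \<alpha>: "\<alpha> 0 \<le> d" and e0: "e 0 = d"
    and p: "p \<in> polys_in (chart_vars d e \<alpha>)"
  shows "\<exists>n. \<exists>g\<in>polys_in (param_vars d e \<alpha>). theta d e \<alpha> (\<alpha> 0) ^ n * p - g \<in> I"
proof -
  let ?B = "polys_in (chart_vars d e \<alpha>)" and ?C = "polys_in (param_vars d e \<alpha>)"
  let ?\<theta> = "theta d e \<alpha> (\<alpha> 0)"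
  note closed = I[unfolded ideal_chart_iff]
  note C = subring_set_intros[OF subring_polys_in[of "param_vars d e \<alpha>"]]
  note B = subring_set_intros[OF subring_polys_in[of "chart_vars d e \<alpha>"]]
  have Iadd: "x + y \<in> I" if "x \<in> I" "y \<in> I" for x y using closed that by blast
  have Imult: "b * x \<in> I" if "b \<in> ?B" "x \<in> I" for b x using closed that by blast
  have \<theta>C: "?\<theta> ^ n \<in> ?C" for n by (intro C theta_in_param_polys)
  have CB: "c \<in> ?B" if "c \<in> ?C" for c using that param_polys_subset_chart by blast
  have IB: "x \<in> ?B" if "x \<in> I" for x using closed that by blast
  show ?thesis
    using p
  proof (induction rule: polys_in_induct)
    case (const c)
    show ?case
      using closed by (intro exI[of _ 0] bexI[of _ "const c"]) (auto simp: const_in_polys_in)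
  next
    case (var v)
    obtain r t where v: "v = (r, t)" by (cases v)
    show ?case
    proof (cases "r = 0")
      case True
      then have t: "t \<le> d" "t \<noteq> \<alpha> 0" using var e0 by (auto simp: v)
      have "theta d e \<alpha> t - coord \<alpha> (0, t) * ?\<theta> \<in> I"
        by (rule theta_minus_coord_theta_in_ideal[OF I minors \<alpha> t(1)])
      then have "(- 1) * (theta d e \<alpha> t - coord \<alpha> (0, t) * ?\<theta>) \<in> I"
        by (intro Imult B)
      then have "?\<theta> ^ 1 * var v - theta d e \<alpha> t \<in> I"
        using True t by (simp add: v coord_def mult.commute)
      then show ?thesis using theta_in_param_polys by blast
    next
      case False
      then have "var v \<in> ?C" using var by (auto simp: v intro!: var_in_polys_in)
      then show ?thesis
        using closed by (intro exI[of _ 0] bexI[of _ "var v"]) auto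
    qed
  next
    case (add p q)
    then obtain m n g h where gh: "g \<in> ?C" "h \<in> ?C" "?\<theta> ^ m * p - g \<in> I" "?\<theta> ^ n * q - h \<in> I"
      by blast
    have "?\<theta> ^ n * (?\<theta> ^ m * p - g) + ?\<theta> ^ m * (?\<theta> ^ n * q - h) \<in> I"
      by (intro Iadd Imult CB \<theta>C gh)
    also have "?\<theta> ^ n * (?\<theta> ^ m * p - g) + ?\<theta> ^ m * (?\<theta> ^ n * q - h) =
        ?\<theta> ^ (m + n) * (p + q) - (?\<theta> ^ n * g + ?\<theta> ^ m * h)"
      by (simp add: algebra_simps power_add)
    finally have "?\<theta> ^ (m + n) * (p + q) - (?\<theta> ^ n * g + ?\<theta> ^ m * h) \<in> I" .
    moreover have "?\<theta> ^ n * g + ?\<theta> ^ m * h \<in> ?C" by (intro C(4) C(5) \<theta>C gh)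
    ultimately show ?case by blast
  next
    case (mult p q)
    then obtain m n g h where gh: "g \<in> ?C" "h \<in> ?C" "?\<theta> ^ m * p - g \<in> I" "?\<theta> ^ n * q - h \<in> I"
      by blast
    \<comment> \<open>This is \<open>P Q - g h = (Q - h) (P - g) + h (P - g) + g (Q - h)\<close>.\<close>
    have "(?\<theta> ^ n * q - h) * (?\<theta> ^ m * p - g) + (h * (?\<theta> ^ m * p - g) + g * (?\<theta> ^ n * q - h)) \<in> I"
      by (intro Iadd Imult CB IB gh)
    also have "(?\<theta> ^ n * q - h) * (?\<theta> ^ m * p - g) +
        (h * (?\<theta> ^ m * p - g) + g * (?\<theta> ^ n * q - h)) = ?\<theta> ^ (m + n) * (p * q) - g * h"
      by (simp add: algebra_simps power_add)
    finally have "?\<theta> ^ (m + n) * (p * q) - g * h \<in> I" .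
    moreover have "g * h \<in> ?C" by (intro C(5) gh)
    ultimately show ?case by blast
  qed
qed

text \<open>
  The inclusion of the minors in the kernel is the computation \<open>\<theta>\<^sub>i (\<theta>\<^sub>j / \<theta>\<^sub>a) = \<theta>\<^sub>j (\<theta>\<^sub>i / \<theta>\<^sub>a)\<close>.  For the converse, a
  multiple \<open>\<theta>\<^sub>a ^ n p\<close> of an element of the kernel lies in the ideal of the minors, and \<open>\<theta>\<^sub>a\<close> has an inverse
  \<open>u\<close> modulo that ideal.
\<close>

lemma T_phi_eq_Gamma_on_chart:
  fixes d :: nat and e \<alpha> :: "nat \<Rightarrow> nat"
  assumes e0: "e 0 = d" and part: "(\<Sum>r=1..d. r * e r) = d" and \<alpha>: "\<alpha> \<in> Lambda d e"
  shows "Idl\<^bsub>chart_ring d e \<alpha>\<^esub> (minors2 d (phi d e \<alpha> :: _ \<Rightarrow> _ \<Rightarrow> 'k::field_char_0 mpoly)) =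
    a_kernel (chart_ring d e \<alpha>) (graph_preimage_ring d e \<alpha>) (graph_comorphism d e \<alpha>)"
    (is "?I = ?N")
proof
  let ?\<theta> = "theta d e \<alpha> (\<alpha> 0) :: 'k mpoly"
  interpret ring "chart_ring d e \<alpha> :: 'k mpoly ring"
    unfolding chart_ring_def by (rule ring_ring_on[OF subring_polys_in])
  have \<alpha>0: "\<alpha> 0 \<le> d" using Lambda_le[OF \<alpha>, of 0] e0 by simp
  have \<theta>: "?\<theta> \<noteq> 0" using theta_nonzero[OF part \<alpha>0] .
  have minors: "minors2 d (phi d e \<alpha>) \<subseteq> carrier (chart_ring d e \<alpha> :: 'k mpoly ring)"
    unfolding carrier_chart_ring using e0 by (rule minors_in_chart)
  show sub: "?I \<subseteq> ?N"
    using e0 \<theta> by (intro genideal_minimal ideal_graph_kernel minors_in_graph_kernel)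
  have I: "ideal ?I (chart_ring d e \<alpha>)" by (rule genideal_ideal[OF minors])
  have minors_I: "minors2 d (phi d e \<alpha>) \<subseteq> ?I" by (rule genideal_self[OF minors])
  have Iadd: "x + y \<in> ?I" if "x \<in> ?I" "y \<in> ?I" for x y
    using I that unfolding ideal_chart_iff by blast
  have Imult: "b * x \<in> ?I" if "b \<in> polys_in (chart_vars d e \<alpha>)" "x \<in> ?I" for b x
    using I that unfolding ideal_chart_iff by blast
  note hom = semiring_hom_graph_comorphism[of d e \<alpha>]
  show "?N \<subseteq> ?I"
  proof
    fix p :: "'k mpoly" assume "p \<in> ?N"
    then have p: "p \<in> polys_in (chart_vars d e \<alpha>)" "graph_comorphism d e \<alpha> p = 0"
      by (simp_all add: mem_graph_kernel_iff)
    obtain n g where g: "g \<in> polys_in (param_vars d e \<alpha>)" "?\<theta> ^ n * p - g \<in> ?I"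
      using chart_poly_reduces_to_param[OF I minors_I \<alpha>0 e0 p(1)] by blast
    have "graph_comorphism d e \<alpha> (?\<theta> ^ n * p - g) = 0"
      using sub g(2) mem_graph_kernel_iff by blast
    then have "frac g = 0"
      by (simp add: semiring_hom_diff[OF hom] semiring_hom_mult[OF hom] p(2)
          graph_comorphism_param[OF g(1)] del: minus_fract)
    then have \<theta>p: "?\<theta> ^ n * p \<in> ?I" using g(2) by (simp add: frac_eq_0_iff)
    obtain u where u: "u \<in> polys_in (chart_vars d e \<alpha>)" "1 - u * ?\<theta> \<in> ?I"
      using theta_invertible_mod_minors[OF I minors_I \<alpha> e0 part] .
    have u\<theta>: "u * ?\<theta> \<in> polys_in (chart_vars d e \<alpha>)"
      by (intro subring_set_intros[OF subring_polys_in] u theta_in_chart)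
    \<comment> \<open>As \<open>1 - u \<theta>\<close> divides \<open>1 - (u \<theta>) ^ n\<close>, the power \<open>u ^ n\<close> inverts \<open>\<theta> ^ n\<close> modulo the ideal.\<close>
    have "(\<Sum>i<n. (u * ?\<theta>) ^ i) \<in> polys_in (chart_vars d e \<alpha>)"
      using u\<theta> by (intro subring_set_sum subring_set_power subring_polys_in)
    then have "(p * (\<Sum>i<n. (u * ?\<theta>) ^ i)) * (1 - u * ?\<theta>) \<in> ?I"
      by (intro Imult u(2) subring_set_mult[OF subring_polys_in] p(1))
    also have "(p * (\<Sum>i<n. (u * ?\<theta>) ^ i)) * (1 - u * ?\<theta>) = p - u ^ n * (?\<theta> ^ n * p)"
    proof -
      have "p - u ^ n * (?\<theta> ^ n * p) = p * (1 - (u * ?\<theta>) ^ n)"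
        by (simp add: algebra_simps power_mult_distrib)
      then show ?thesis by (simp only: one_diff_power_eq mult_ac)
    qed
    finally have "(p - u ^ n * (?\<theta> ^ n * p)) + u ^ n * (?\<theta> ^ n * p) \<in> ?I"
      by (rule Iadd) (intro Imult \<theta>p u(1) subring_set_power[OF subring_polys_in])
    then show "p \<in> ?I" by simp
  qed
qed


section \<open>Overlaps of charts\<close>

lemma semiring_hom_chart_emb: "semiring_hom (chart_emb \<alpha>)"
  unfolding chart_emb_def by (rule semiring_hom_subst[OF semiring_hom_frac_const])

lemma frac_var_nonzero: "frac (var v) \<noteq> 0"
  by (simp add: frac_eq_0_iff var_def) (metis lookup_single_eq lookup_zero zero_neq_one)

lemma chart_emb_coord: "chart_emb \<alpha> (coord \<alpha> (r, t)) = frac (var (r, t)) / frac (var (r, \<alpha> r))"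
  by (simp add: coord_def chart_emb_def semiring_hom_1[OF semiring_hom_subst[OF semiring_hom_frac_const]]
      subst_var[OF semiring_hom_frac_const] frac_var_nonzero del: divide_fract)

lemma chart_emb_const: "chart_emb \<alpha> (const c) = frac (const c)"
  unfolding chart_emb_def by (rule subst_const[OF semiring_hom_frac_const])

lemma chart_emb_theta:
  "chart_emb \<alpha> (theta d e \<alpha> j) =
    frac (Theta d e j) / (\<Prod>r=1..d. frac (var (r, \<alpha> r)) ^ r)"
proof -
  let ?\<rho> = "\<lambda>(r, t). inverse (frac (var (r, \<alpha> r))) * (\<lambda>v. frac (var v)) (r, t)"
  have "chart_emb \<alpha> (theta d e \<alpha> j) =
      coeff (coeff (power_product d e (\<lambda>v. chart_emb \<alpha> (coord \<alpha> v))) (d - j)) j"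
    by (simp only: theta_eq coeff_power_product_hom[OF semiring_hom_chart_emb])
  also have "(\<lambda>v. chart_emb \<alpha> (coord \<alpha> v)) = ?\<rho>"
    by (auto simp only: chart_emb_coord divide_inverse mult.commute split: prod.split)
  also have "coeff (coeff (power_product d e ?\<rho>) (d - j)) j =
      (\<Prod>r=1..d. inverse (frac (var (r, \<alpha> r))) ^ r) *
      coeff (coeff (power_product d e (\<lambda>v. frac (var v))) (d - j)) j"
    by (rule coeff_power_product_scale)
  also have "coeff (coeff (power_product d e (\<lambda>v. frac (var v))) (d - j)) j = frac (Theta d e j)"
    unfolding Theta_def generic_product_eq_power_product
    by (rule coeff_power_product_hom[OF semiring_hom_frac, symmetric])
  also have "(\<Prod>r=1..d. inverse (frac (var (r, \<alpha> r))) ^ r) =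
      inverse (\<Prod>r=1..d. frac (var (r, \<alpha> r)) ^ r)"
    using prod_inversef[of "\<lambda>r. frac (var (r, \<alpha> r)) ^ r" "{1..d}"]
    by (simp only: comp_def power_inverse)
  finally show ?thesis
    unfolding divide_inverse by (subst (asm) mult.commute)
qed


text \<open>
  The ratio of the monomials that dehomogenize the minors on two charts is itself a regular function
  on \<open>U_\<alpha>\<close>; exchanging the charts gives its inverse on the overlap.
\<close>

lemma chart_emb_unit:
  "chart_emb \<alpha> (coord \<alpha> (0, \<beta> 0) * (\<Prod>r=1..d. coord \<alpha> (r, \<beta> r) ^ r)) =
    (frac (var (0, \<beta> 0)) * (\<Prod>r=1..d. frac (var (r, \<beta> r)) ^ r)) /
    (frac (var (0, \<alpha> 0)) * (\<Prod>r=1..d. frac (var (r, \<alpha> r)) ^ r))"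
  by (simp only: semiring_hom_mult[OF semiring_hom_chart_emb] semiring_hom_prod[OF semiring_hom_chart_emb]
      semiring_hom_power[OF semiring_hom_chart_emb] chart_emb_coord power_divide prod_dividef
      times_divide_times_eq)

lemma chart_emb_minor:
  "chart_emb \<alpha> (theta d e \<alpha> i * coord \<alpha> (0, j) - theta d e \<alpha> j * coord \<alpha> (0, i) :: 'k::field mpoly) =
    (frac (Theta d e i) * frac (var (0, j)) - frac (Theta d e j) * frac (var (0, i))) /
    (frac (var (0, \<alpha> 0)) * (\<Prod>r=1..d. frac (var (r, \<alpha> r)) ^ r))"
proof -
  have quotients: "a / q * (x / c) - b / q * (y / c) = (a * x - b * y) / (c * q)"
    for a b c q x y :: "'k mpoly fract"
    by (simp only: times_divide_times_eq diff_divide_distrib[symmetric] mult.commute[of q c])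
  show ?thesis
    by (simp only: semiring_hom_diff[OF semiring_hom_chart_emb] semiring_hom_mult[OF semiring_hom_chart_emb]
        chart_emb_theta chart_emb_coord quotients)
qed

lemma chart_emb_minor_transition:
  "chart_emb \<alpha> (theta d e \<alpha> i * coord \<alpha> (0, j) - theta d e \<alpha> j * coord \<alpha> (0, i) :: 'k::field mpoly) =
    chart_emb \<alpha> (coord \<alpha> (0, \<beta> 0) * (\<Prod>r=1..d. coord \<alpha> (r, \<beta> r) ^ r)) *
    chart_emb \<beta> (theta d e \<beta> i * coord \<beta> (0, j) - theta d e \<beta> j * coord \<beta> (0, i))"
proof -
  have "frac (var (0, \<beta> 0)) * (\<Prod>r=1..d. frac (var (r, \<beta> r)) ^ r) \<noteq> (0 :: 'k mpoly fract)"
    by (simp add: frac_var_nonzero del: mult_fract)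
  moreover have "m / a = b / a * (m / b)" if "b \<noteq> 0" for a b m :: "'k mpoly fract"
    using that by simp
  ultimately show ?thesis
    unfolding chart_emb_minor chart_emb_unit by blast
qed

lemma carrier_overlap_ring:
  "carrier (overlap_ring d e \<alpha> \<beta>) =
    {chart_emb \<alpha> p / chart_emb \<alpha> (\<Prod>r\<le>d. coord \<alpha> (r, \<beta> r)) ^ n | p n.
      p \<in> polys_in (chart_vars d e \<alpha>)}"
  by (simp add: overlap_ring_def ring_on_simps carrier_chart_ring)

lemma transition_nonzero: "chart_emb \<alpha> (\<Prod>r\<in>A. coord \<alpha> (r, \<beta> r)) \<noteq> 0"
  by (induction A rule: infinite_finite_induct)
    (simp_all add: semiring_hom_simps[OF semiring_hom_chart_emb] chart_emb_coord frac_var_nonzero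
      del: divide_fract)

lemma subring_overlap:
  assumes \<beta>: "\<beta> \<in> Lambda d e"
  shows "subring_set (carrier (overlap_ring d e \<alpha> \<beta> :: 'k::field mpoly fract ring))"
proof -
  let ?B = "polys_in (chart_vars d e \<alpha>) :: 'k mpoly set"
  let ?P = "(\<Prod>r\<le>d. coord \<alpha> (r, \<beta> r)) :: 'k mpoly"
  note hom = semiring_hom_chart_emb[of \<alpha>] and B = subring_polys_in[of "chart_vars d e \<alpha>"]
  have P: "?P ^ n \<in> ?B" for n
    by (intro subring_set_power subring_set_prod B coord_in_chart) (auto intro: Lambda_le[OF \<beta>])
  have P0: "chart_emb \<alpha> ?P \<noteq> 0" by (rule transition_nonzero)
  have S: "x \<in> carrier (overlap_ring d e \<alpha> \<beta>) \<longleftrightarrow>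
      (\<exists>p\<in>?B. \<exists>n. x = chart_emb \<alpha> p / chart_emb \<alpha> ?P ^ n)" for x
    unfolding carrier_overlap_ring by blast
  show ?thesis
    unfolding subring_set_def
  proof (intro conjI ballI)
    show "1 \<in> carrier (overlap_ring d e \<alpha> \<beta> :: 'k mpoly fract ring)"
      unfolding S by (rule bexI[of _ 1], rule exI[of _ 0])
        (simp_all add: semiring_hom_1[OF hom] subring_set_1[OF B])
  next
    fix x :: "'k mpoly fract" assume "x \<in> carrier (overlap_ring d e \<alpha> \<beta>)"
    then obtain p n where p: "p \<in> ?B" "x = chart_emb \<alpha> p / chart_emb \<alpha> ?P ^ n" unfolding S by blast
    have "- x = chart_emb \<alpha> (- p) / chart_emb \<alpha> ?P ^ n"
      using semiring_hom_diff[OF hom, of 0 p] by (simp add: p(2) semiring_hom_0[OF hom])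
    then show "- x \<in> carrier (overlap_ring d e \<alpha> \<beta>)"
      unfolding S using subring_set_uminus[OF B p(1)] by blast
  next
    fix x y :: "'k mpoly fract"
    assume "x \<in> carrier (overlap_ring d e \<alpha> \<beta>)" "y \<in> carrier (overlap_ring d e \<alpha> \<beta>)"
    then obtain p n q m where p: "p \<in> ?B" "x = chart_emb \<alpha> p / chart_emb \<alpha> ?P ^ n"
      and q: "q \<in> ?B" "y = chart_emb \<alpha> q / chart_emb \<alpha> ?P ^ m" unfolding S by blast
    have "x + y = chart_emb \<alpha> (p * ?P ^ m + q * ?P ^ n) / chart_emb \<alpha> ?P ^ (n + m)"
      using P0 by (simp add: p(2) q(2) semiring_hom_add[OF hom] semiring_hom_mult[OF hom]
          semiring_hom_power[OF hom] add_frac_eq power_add)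
    moreover have "p * ?P ^ m + q * ?P ^ n \<in> ?B"
      by (intro subring_set_add[OF B] subring_set_mult[OF B] p(1) q(1) P)
    ultimately show "x + y \<in> carrier (overlap_ring d e \<alpha> \<beta>)" unfolding S by blast
    have "x * y = chart_emb \<alpha> (p * q) / chart_emb \<alpha> ?P ^ (n + m)"
      by (simp add: p(2) q(2) semiring_hom_mult[OF hom] power_add)
    moreover have "p * q \<in> ?B" by (intro subring_set_mult[OF B] p(1) q(1))
    ultimately show "x * y \<in> carrier (overlap_ring d e \<alpha> \<beta>)" unfolding S by blast
  qed
qed

lemma chart_emb_in_overlap_left:
  assumes "p \<in> polys_in (chart_vars d e \<alpha>)"
  shows "chart_emb \<alpha> p \<in> carrier (overlap_ring d e \<alpha> \<beta>)"
proof -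
  have "chart_emb \<alpha> p = chart_emb \<alpha> p / chart_emb \<alpha> (\<Prod>r\<le>d. coord \<alpha> (r, \<beta> r)) ^ 0" by simp
  then show ?thesis unfolding carrier_overlap_ring using assms by blast
qed

text \<open>
  \<open>overlap_ring\<close> is built from the chart \<open>\<alpha>\<close>, and for the chart \<open>\<beta>\<close> one has to write
  \<open>X_{r,t} / X_{r,\<beta> r}\<close> with a denominator that is a power of the product of all the coordinates
  \<open>X_{s,\<beta> s} / X_{s,\<alpha> s}\<close>: the fraction is expanded by the factors with \<open>s \<noteq> r\<close>.
\<close>

lemma chart_emb_in_overlap_right:
  fixes p :: "'k::field mpoly"
  assumes \<beta>: "\<beta> \<in> Lambda d e" and p: "p \<in> polys_in (chart_vars d e \<beta>)"
  shows "chart_emb \<beta> p \<in> carrier (overlap_ring d e \<alpha> \<beta>)"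
  using p
proof (induction rule: polys_in_induct)
  case (const c)
  then show ?case
    using chart_emb_in_overlap_left[OF const_in_polys_in, of \<alpha> c]
    by (simp add: chart_emb_const)
next
  case (var v)
  obtain r t where v: "v = (r, t)" and r: "r \<le> d" and t: "t \<le> e r" "t \<noteq> \<beta> r"
    using var by auto
  let ?Q = "\<Prod>s\<in>{..d} - {r}. coord \<alpha> (s, \<beta> s) :: 'k mpoly"
  have Q: "chart_emb \<alpha> ?Q \<noteq> 0" by (rule transition_nonzero)
  have "(\<Prod>s\<le>d. coord \<alpha> (s, \<beta> s)) = coord \<alpha> (r, \<beta> r) * ?Q"
    using r by (intro prod.remove) auto
  then have "chart_emb \<alpha> (coord \<alpha> (r, t) * ?Q) / chart_emb \<alpha> (\<Prod>s\<le>d. coord \<alpha> (s, \<beta> s)) ^ 1 =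
      (frac (var (r, t)) / frac (var (r, \<alpha> r))) / (frac (var (r, \<beta> r)) / frac (var (r, \<alpha> r)))"
    using Q
    by (simp add: semiring_hom_mult[OF semiring_hom_chart_emb] chart_emb_coord
        del: divide_fract mult_fract)
  also have "\<dots> = frac (var (r, t)) / frac (var (r, \<beta> r))"
    by (simp add: frac_var_nonzero del: divide_fract mult_fract)
  also have "\<dots> = chart_emb \<beta> (var v)"
  proof -
    have "chart_emb \<beta> (coord \<beta> (r, t) :: 'k mpoly) = frac (var (r, t)) / frac (var (r, \<beta> r))"
      by (rule chart_emb_coord)
    then show ?thesis using t by (simp add: v coord_def)
  qed
  finally have "chart_emb \<beta> (var v) =
      chart_emb \<alpha> (coord \<alpha> (r, t) * ?Q) / chart_emb \<alpha> (\<Prod>s\<le>d. coord \<alpha> (s, \<beta> s)) ^ 1" by (rule sym)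
  moreover have "coord \<alpha> (r, t) * ?Q \<in> polys_in (chart_vars d e \<alpha>)"
    by (intro subring_set_mult subring_set_prod subring_polys_in coord_in_chart)
      (use r t Lambda_le[OF \<beta>] in auto)
  ultimately show ?case unfolding carrier_overlap_ring by blast
next
  case (add p q)
  then show ?case
    by (simp only: semiring_hom_add[OF semiring_hom_chart_emb] subring_set_add[OF subring_overlap[OF \<beta>]])
next
  case (mult p q)
  then show ?case
    by (simp only: semiring_hom_mult[OF semiring_hom_chart_emb] subring_set_mult[OF subring_overlap[OF \<beta>]])
qed

text \<open>
  Stated for any ring \<open>S\<close> containing both coordinate rings, so that it applies with the charts in
  either order although \<open>overlap_ring\<close> is not symmetric in them.
\<close>

lemma minor_ideals_agree_one_direction:
  fixes S :: "'k::field mpoly fract set"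
  assumes e0: "e 0 = d" and \<beta>: "\<beta> \<in> Lambda d e" and S: "subring_set S"
    and emb_\<alpha>: "\<And>p. p \<in> polys_in (chart_vars d e \<alpha>) \<Longrightarrow> chart_emb \<alpha> p \<in> S"
    and emb_\<beta>: "\<And>p. p \<in> polys_in (chart_vars d e \<beta>) \<Longrightarrow> chart_emb \<beta> p \<in> S"
  shows "Idl\<^bsub>ring_on S\<^esub> (chart_emb \<alpha> ` (Idl\<^bsub>chart_ring d e \<alpha>\<^esub> (minors2 d (phi d e \<alpha>)))) \<subseteq>
    Idl\<^bsub>ring_on S\<^esub> (chart_emb \<beta> ` (Idl\<^bsub>chart_ring d e \<beta>\<^esub> (minors2 d (phi d e \<beta>))))"
proof -
  let ?I = "\<lambda>\<alpha>. Idl\<^bsub>chart_ring d e \<alpha>\<^esub> (minors2 d (phi d e \<alpha>)) :: 'k mpoly set"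
  let ?J = "Idl\<^bsub>ring_on S\<^esub> (chart_emb \<beta> ` ?I \<beta>)"
  note hom = semiring_hom_chart_emb[of \<alpha>]
  interpret S: ring "ring_on S" by (rule ring_ring_on[OF S])
  have chart: "ring (chart_ring d e \<gamma> :: 'k mpoly ring)" for \<gamma>
    unfolding chart_ring_def by (rule ring_ring_on[OF subring_polys_in])
  have minors: "minors2 d (phi d e \<gamma>) \<subseteq> carrier (chart_ring d e \<gamma> :: 'k mpoly ring)" for \<gamma>
    unfolding carrier_chart_ring using e0 by (rule minors_in_chart)
  have "ideal (?I \<beta>) (chart_ring d e \<beta>)" by (rule ring.genideal_ideal[OF chart minors])
  then have sub_S: "chart_emb \<beta> ` ?I \<beta> \<subseteq> carrier (ring_on S)"
    using emb_\<beta> unfolding ideal_chart_iff ring_on_simps by blast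
  have J: "ideal ?J (ring_on S)" by (rule S.genideal_ideal[OF sub_S])
  have Jadd: "x + y \<in> ?J" if "x \<in> ?J" "y \<in> ?J" for x y
    using J that unfolding ideal_ring_on_iff[OF S] by blast
  have Jmult: "b * x \<in> ?J" if "b \<in> S" "x \<in> ?J" for b x
    using J that unfolding ideal_ring_on_iff[OF S] by blast
  have J0: "0 \<in> ?J" using J unfolding ideal_ring_on_iff[OF S] by blast
  \<comment> \<open>The contraction of \<open>?J\<close> to \<open>U_\<alpha>\<close> is an ideal, so it suffices that it contains the minors.\<close>
  define K where "K = {p \<in> polys_in (chart_vars d e \<alpha>). chart_emb \<alpha> p \<in> ?J}"
  have K: "ideal K (chart_ring d e \<alpha>)"
    unfolding ideal_chart_iff
    by (auto simp: K_def semiring_hom_simps[OF hom] J0 intro!: Jadd Jmult emb_\<alpha>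
        subring_set_0[OF subring_polys_in] subring_set_add[OF subring_polys_in]
        subring_set_mult[OF subring_polys_in])
  have "minors2 d (phi d e \<alpha>) \<subseteq> K"
  proof
    fix p :: "'k mpoly" assume p: "p \<in> minors2 d (phi d e \<alpha>)"
    then obtain i j where ij: "i < j" "j \<le> d"
      "p = theta d e \<alpha> i * coord \<alpha> (0, j) - theta d e \<alpha> j * coord \<alpha> (0, i)"
      unfolding minors2_phi by blast
    let ?q = "theta d e \<beta> i * coord \<beta> (0, j) - theta d e \<beta> j * coord \<beta> (0, i)"
    have "?q \<in> minors2 d (phi d e \<beta>)" using ij unfolding minors2_phi by blast
    then have "?q \<in> ?I \<beta>" using ring.genideal_self[OF chart minors] by blast
    then have q: "chart_emb \<beta> ?q \<in> ?J" using S.genideal_self[OF sub_S] by blast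
    have "coord \<alpha> (0, \<beta> 0) * (\<Prod>r=1..d. coord \<alpha> (r, \<beta> r) ^ r) \<in> polys_in (chart_vars d e \<alpha>)"
      by (intro subring_set_mult subring_set_prod subring_set_power subring_polys_in coord_in_chart)
        (auto intro: Lambda_le[OF \<beta>])
    then have "chart_emb \<alpha> p \<in> ?J"
      unfolding ij(3) chart_emb_minor_transition[of \<alpha> d e i j \<beta>] by (intro Jmult emb_\<alpha> q)
    moreover have "p \<in> polys_in (chart_vars d e \<alpha>)"
      using p minors unfolding carrier_chart_ring by blast
    ultimately show "p \<in> K" by (simp add: K_def)
  qed
  then have "?I \<alpha> \<subseteq> K" by (intro ring.genideal_minimal[OF chart] K)
  then show ?thesis by (intro S.genideal_minimal J) (auto simp: K_def)
qed

lemma closed_subscheme_T_phi: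
  assumes e0: "e 0 = d"
  shows "closed_subscheme d e (T_phi d e :: 'k::field ideal_family)"
proof -
  have chart: "ring (chart_ring d e \<alpha> :: 'k mpoly ring)" for \<alpha>
    unfolding chart_ring_def by (rule ring_ring_on[OF subring_polys_in])
  have minors: "minors2 d (phi d e \<alpha>) \<subseteq> carrier (chart_ring d e \<alpha> :: 'k mpoly ring)" for \<alpha>
    unfolding carrier_chart_ring using e0 by (rule minors_in_chart)
  have overlap: "Idl\<^bsub>overlap_ring d e \<alpha> \<beta>\<^esub> (chart_emb \<alpha> ` (T_phi d e \<alpha> :: 'k mpoly set)) =
      Idl\<^bsub>overlap_ring d e \<alpha> \<beta>\<^esub> (chart_emb \<beta> ` T_phi d e \<beta>)"
    if \<alpha>: "\<alpha> \<in> Lambda d e" and \<beta>: "\<beta> \<in> Lambda d e" for \<alpha> \<beta>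
  proof -
    let ?S = "carrier (overlap_ring d e \<alpha> \<beta>) :: 'k mpoly fract set"
    have "overlap_ring d e \<alpha> \<beta> = ring_on ?S"
      by (simp add: overlap_ring_def ring_on_simps)
    note S = this subring_overlap[OF \<beta>]
    show ?thesis
      unfolding T_phi_def restrict_apply'[OF \<alpha>] restrict_apply'[OF \<beta>]
      by (subst (1 2) S(1), intro equalityI minor_ideals_agree_one_direction e0 \<alpha> \<beta> S(2)
          chart_emb_in_overlap_left chart_emb_in_overlap_right)
  qed
  show ?thesis
    unfolding closed_subscheme_def
    using overlap ring.genideal_ideal[OF chart minors] by (auto simp: T_phi_def)
qed

theorem theorem1p5:
  fixes d :: nat and e :: "nat \<Rightarrow> nat"
  assumes "d \<ge> 1"
    and "e 0 = d"
    and "(\<Sum>r=1..d. r * e r) = d"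
  shows "closed_subscheme d e (T_phi d e :: 'k::{alg_closed_field, field_char_0} ideal_family) \<and>
         closed_subscheme d e (Gamma d e :: 'k ideal_family) \<and>
         (T_phi d e :: 'k ideal_family) = Gamma d e"
proof -
  have "(T_phi d e :: 'k ideal_family) = Gamma d e"
    unfolding T_phi_def Gamma_def
    using assms(2,3) by (intro restrict_ext T_phi_eq_Gamma_on_chart)
  moreover have "closed_subscheme d e (T_phi d e :: 'k ideal_family)"
    using assms(2) by (rule closed_subscheme_T_phi)
  ultimately show ?thesis by simp
qed

end
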